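(* Consider a sequence of problems $(A,S,d,m)_n$ with deterministic $A\in\mathbb{R}^{n\times d}$ and $S\in\mathbb{R}^{m\times n}$ having i.i.d. $\mathcal N(0,\frac1m)$ entries, with $m,d\to\infty$ and $d/m\to y\in[0,1)$. Assume the empirical spectral distribution of $\frac1nA^TA$ converges almost surely to a distribution $F_\Sigma$ at almost every $u\ge0$, $\|n^{-1}A^TA\|^2<\infty$, and the eigenvalues of each $\frac1nA^TA$ lie in $[\sigma_{\min},\sigma_{\max}]$ with $\sigma_{\min}>0$ and $\sigma_{\max}$ independent of $n$. Let $H=\frac1nA^TA+\lambda I$, $H_S=\frac1nA^TS^TSA+\lambda I$, $d_\lambda^n=\mathrm{tr}\left(\frac1nA^TA\left(\frac1nA^TA+\lambda I\right)^{-1}\right)$, and assume $d_\lambda^n<m$ always. Then for any $\lambda>0$, \[\lim_{m,d\to\infty}\left\|\mathbb{E}\left[\left(\frac{1}{1-\frac{d_\lambda^n}{m}}(H_S-\lambda I)+\lambda I\right)^{-1}\right]-H^{-1}\right\|=0.\]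
   Context: The empirical spectral distribution of a symmetric $d\times d$ matrix $B$ is $F_B(u)=d^{-1}\#\{i:\lambda_i(B)\le u\}$. $\|\cdot\|$ is the spectral norm. *)

theory Defs
  imports "HOL-Probability.Probability" "Jordan_Normal_Form.Gauss_Jordan_Elimination"
    "Jordan_Normal_Form.Char_Poly"
begin

definition mat_tr :: "real mat \<Rightarrow> real" where
  "mat_tr B = (\<Sum>i<dim_row B. B $$ (i, i))"

definition vec_enorm :: "real vec \<Rightarrow> real" where
  "vec_enorm x = sqrt (\<Sum>i<dim_vec x. (x $ i)^2)"

definition spec_norm :: "real mat \<Rightarrow> real" where
  "spec_norm B = Sup {vec_enorm (B *\<^sub>v x) | x. x \<in> carrier_vec (dim_col B) \<and> vec_enorm x \<le> 1}"

definition mat_inv :: "real mat \<Rightarrow> real mat" where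
  "mat_inv B = the (mat_inverse B)"

definition esd :: "real mat \<Rightarrow> real \<Rightarrow> real" where
  "esd B u = (\<Sum>r\<in>{r. poly (char_poly B) r = 0 \<and> r \<le> u}. real (order r (char_poly B)))
              / real (dim_row B)"

definition gauss_mat_space :: "nat \<Rightarrow> nat \<Rightarrow> ((nat \<times> nat) \<Rightarrow> real) measure" where
  "gauss_mat_space m n = PiM ({..<m} \<times> {..<n}) (\<lambda>_. density lborel (normal_density 0 (sqrt (1 / real m))))"

definition mat_of_sample :: "nat \<Rightarrow> nat \<Rightarrow> ((nat \<times> nat) \<Rightarrow> real) \<Rightarrow> real mat" where
  "mat_of_sample m n \<omega> = mat m n (\<lambda>(i, j). \<omega> (i, j))"

definition mat_expect :: "'s measure \<Rightarrow> nat \<Rightarrow> nat \<Rightarrow> ('s \<Rightarrow> real mat) \<Rightarrow> real mat" where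
  "mat_expect M r c X = mat r c (\<lambda>(i, j). integral\<^sup>L M (\<lambda>\<omega>. X \<omega> $$ (i, j)))"

definition gram :: "nat \<Rightarrow> real mat \<Rightarrow> real mat" where
  "gram n A = (1 / real n) \<cdot>\<^sub>m (transpose_mat A * A)"

definition H_mat :: "nat \<Rightarrow> nat \<Rightarrow> real mat \<Rightarrow> real \<Rightarrow> real mat" where
  "H_mat n d A lam = gram n A + lam \<cdot>\<^sub>m 1\<^sub>m d"

definition HS_mat :: "nat \<Rightarrow> nat \<Rightarrow> real mat \<Rightarrow> real mat \<Rightarrow> real \<Rightarrow> real mat" where
  "HS_mat n d A S lam = (1 / real n) \<cdot>\<^sub>m (transpose_mat A * transpose_mat S * S * A) + lam \<cdot>\<^sub>m 1\<^sub>m d"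

definition eff_dim :: "nat \<Rightarrow> nat \<Rightarrow> real mat \<Rightarrow> real \<Rightarrow> real" where
  "eff_dim n d A lam = mat_tr (gram n A * mat_inv (gram n A + lam \<cdot>\<^sub>m 1\<^sub>m d))"

end

theory Submission
  imports Defs "HOL-Real_Asymp.Real_Asymp"
begin

text \<open>
  Put $\gamma = (1 - d_\lambda/m)^{-1}$ and $Q = (\gamma(H_S - \lambda I) + \lambda I)^{-1}$. The rows
  $x_1, \dots, x_m$ of $\sqrt{\gamma/n}\, S A$ satisfy $Q^{-1} = \lambda I + \sum_i x_i x_i^T$. Gaussian
  integration by parts in the entries of $S$ turns $I - \lambda\,\mathbf{E} Q = \mathbf{E} \sum_i Q x_i x_i^T$
  into $\gamma(1-t)\, \mathbf{E}[Q]\, \Sigma$ up to an error of operator norm $O(m^{-1/2})$, where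
  $\Sigma = \frac1n A^T A$ and $t = (d - \lambda\, \mathbf{E}\, \mathrm{tr}\, Q)/m$. The error involves only the
  fluctuation of $\mathrm{tr}\, Q$, which the Efron--Stein inequality controls, because changing one row
  moves the trace by at most $1/\lambda$.

  Multiplying by $P = H^{-1}$ gives
  $\mathbf{E} Q - P = (1 - \gamma(1-t))\, \mathbf{E}[Q]\, \Sigma P + \mathrm{error}$. The choice of $\gamma$ means that
  $1 - \gamma(1-t)$ is $-\gamma\lambda/m$ times $\mathrm{tr}(\mathbf{E} Q - P)$, so taking traces yields a linear
  equation for it, which is stable because $\mathrm{tr}(\mathbf{E}[Q]\, \Sigma P) \ge 0$. Hence
  $\gamma(1-t) \to 1$ and then $\mathbf{E} Q \to P$ in norm.
\<close>

unbundle no vec_syntax and no inner_syntax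

section \<open>Resolvents of sums of rank-one matrices\<close>

text \<open>The obstacle is that every row enters Q, while integration by parts needs derivatives in
  single entries that are bounded over all samples. Deleting one row x_i settles this: Q is a
  rational function of x_i with coefficients from the resolvent R without that row, and the
  Sherman-Morrison denominator D = 1 + x_i . R x_i is at least 1. Hence x_i . Q x_i \<le> 1 and |Q
  x_i|^2 \<le> 1/\<lambda> however long the Gaussian row is. The factor 1 - t is the mean of 1/D
  over the rows: 1/D = 1 - x_i . Q x_i, and the x_i . Q x_i sum to d - \<lambda> tr Q.

  The error of the averaged identity carries \<Sigma> v; evaluating at v = P z replaces it by
  \<Sigma> P z = z - \<lambda> P z, of length at most 2 |z|. Summing over a basis may cost a factor
  d in the trace, but the trace only enters divided by m, and d/m stays bounded. The factor \<gamma>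
  stays bounded because d_lambda \<le> d and y < 1.

  Operators are handled through bilinear forms u . Q v throughout; the spectral norm appears only
  when the final estimate is read off.\<close>

lemma vec_enorm_sq: "(vec_enorm v)\<^sup>2 = v \<bullet> v"
  by (simp add: vec_enorm_def scalar_prod_def sum_nonneg power2_eq_square atLeast0LessThan)

lemma vec_enorm_nonneg [simp]: "0 \<le> vec_enorm v"
  by (simp add: vec_enorm_def sum_nonneg)

lemma vec_enorm_sqrt: "vec_enorm v = sqrt (v \<bullet> v)"
  by (metis vec_enorm_sq vec_enorm_nonneg real_sqrt_unique)

lemma scalar_prod_self_nonneg [simp]: "0 \<le> v \<bullet> (v :: real vec)"
  by (metis vec_enorm_sq zero_le_power2)

lemma scalar_prod_self_eq_0:
  assumes "v \<in> carrier_vec d" "v \<bullet> v = (0::real)"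
  shows "v = 0\<^sub>v d"
proof (rule eq_vecI)
  have "(\<Sum>i\<in>{0..<d}. v $ i * v $ i) = 0"
    using assms by (simp add: scalar_prod_def)
  then show "v $ i = 0\<^sub>v d $ i" if "i < dim_vec (0\<^sub>v d)" for i
    using that by (subst (asm) sum_nonneg_eq_0_iff) auto
qed (use assms in auto)

lemma scalar_prod_vec_enorm_le:
  assumes "u \<in> carrier_vec d" "v \<in> carrier_vec d"
  shows "\<bar>u \<bullet> v\<bar> \<le> vec_enorm u * vec_enorm v"
proof -
  have "\<bar>u \<bullet> v\<bar> \<le> (\<Sum>i\<in>{0..<d}. \<bar>u $ i\<bar> * \<bar>v $ i\<bar>)"
    unfolding scalar_prod_def using assms
    by (auto intro!: order_trans[OF sum_abs] simp: abs_mult)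
  also have "\<dots> \<le> L2_set (($) u) {0..<d} * L2_set (($) v) {0..<d}"
    by (rule L2_set_mult_ineq)
  also have "\<dots> = vec_enorm u * vec_enorm v"
    using assms by (simp add: L2_set_def vec_enorm_def atLeast0LessThan)
  finally show ?thesis .
qed

lemma vec_enorm_unit [simp]: "a < d \<Longrightarrow> vec_enorm (unit_vec d a) = 1"
  by (simp add: vec_enorm_sqrt)

lemma vec_enorm_smult: "vec_enorm (c \<cdot>\<^sub>v v) = \<bar>c\<bar> * vec_enorm v"
  by (simp add: vec_enorm_def power_mult_distrib real_sqrt_mult flip: sum_distrib_left)

text \<open>Resolution of the identity in the standard basis. It collapses traces of rank-one terms
  and of products of resolvents.\<close>

lemma unit_vec_sum_scalar_prod:
  assumes "u \<in> carrier_vec d" "v \<in> carrier_vec d"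
  shows "(\<Sum>a<d. (unit_vec d a \<bullet> u) * (v \<bullet> unit_vec d a)) = u \<bullet> (v :: real vec)"
  using assms by (simp add: scalar_prod_def[of u v] atLeast0LessThan)

lemma unit_vec_scalar_prod_mat:
  assumes "B \<in> carrier_mat d d" "a < d" "b < d"
  shows "unit_vec d a \<bullet> (B *\<^sub>v unit_vec d b) = (B $$ (a, b) :: real)"
  using assms by simp

text \<open>The matrix lam I + sum of x_i x_i^T. One constant serves for the inverse of Q, for H
  and, with \<open>lam = 0\<close>, for the population matrix \<open>W\<close>; the explicit index
  set allows one vector to be removed.\<close>

definition reg_mat :: "nat \<Rightarrow> real \<Rightarrow> 'i set \<Rightarrow> ('i \<Rightarrow> real vec) \<Rightarrow> real mat" where
  "reg_mat d lam I x = mat d d (\<lambda>(a, b). (if a = b then lam else 0) + (\<Sum>i\<in>I. x i $ a * x i $ b))"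

lemma reg_mat_carrier [simp]: "reg_mat d lam I x \<in> carrier_mat d d"
  by (simp add: reg_mat_def)

lemma reg_mat_scalar_prod:
  assumes u: "u \<in> carrier_vec d" and v: "v \<in> carrier_vec d"
    and x: "\<And>i. i \<in> I \<Longrightarrow> x i \<in> carrier_vec d"
  shows "u \<bullet> (reg_mat d lam I x *\<^sub>v v) = lam * (u \<bullet> v) + (\<Sum>i\<in>I. (u \<bullet> x i) * (x i \<bullet> v))"
proof -
  have "u \<bullet> (reg_mat d lam I x *\<^sub>v v)
     = (\<Sum>a\<in>{0..<d}. u $ a * (\<Sum>b\<in>{0..<d}. ((if a = b then lam else 0) + (\<Sum>i\<in>I. x i $ a * x i $ b)) * v $ b))"
    using v by (simp add: scalar_prod_def reg_mat_def)
  also have "\<dots> = (\<Sum>a\<in>{0..<d}. lam * (u $ a * v $ a)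
        + (\<Sum>b\<in>{0..<d}. \<Sum>i\<in>I. u $ a * x i $ a * (x i $ b * v $ b)))"
  proof (rule sum.cong[OF refl])
    fix a assume a: "a \<in> {0..<d}"
    have "(\<Sum>b\<in>{0..<d}. (if a = b then lam else 0) * v $ b) = lam * v $ a"
      using a by (simp add: if_distrib[of "\<lambda>z. z * _"] sum.delta cong: if_cong)
    then show "u $ a * (\<Sum>b\<in>{0..<d}. ((if a = b then lam else 0) + (\<Sum>i\<in>I. x i $ a * x i $ b)) * v $ b)
      = lam * (u $ a * v $ a) + (\<Sum>b\<in>{0..<d}. \<Sum>i\<in>I. u $ a * x i $ a * (x i $ b * v $ b))"
      by (simp add: distrib_right sum.distrib distrib_left sum_distrib_left sum_distrib_right mult_ac)
  qed
  also have "\<dots> = lam * (u \<bullet> v) + (\<Sum>a\<in>{0..<d}. \<Sum>b\<in>{0..<d}. \<Sum>i\<in>I. u $ a * x i $ a * (x i $ b * v $ b))"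
    using v by (simp add: sum.distrib scalar_prod_def sum_distrib_left)
  also have "(\<Sum>a\<in>{0..<d}. \<Sum>b\<in>{0..<d}. \<Sum>i\<in>I. u $ a * x i $ a * (x i $ b * v $ b))
     = (\<Sum>i\<in>I. \<Sum>a\<in>{0..<d}. \<Sum>b\<in>{0..<d}. u $ a * x i $ a * (x i $ b * v $ b))"
    by (rule trans[OF sum.cong[OF refl sum.swap] sum.swap])
  also have "\<dots> = (\<Sum>i\<in>I. (u \<bullet> x i) * (x i \<bullet> v))"
    using v x by (intro sum.cong[OF refl]) (simp add: scalar_prod_def sum_product carrier_vecD[OF x])
  finally show ?thesis .
qed

definition resolvent :: "nat \<Rightarrow> real \<Rightarrow> 'i set \<Rightarrow> ('i \<Rightarrow> real vec) \<Rightarrow> real mat" where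
  "resolvent d lam I x = mat_inv (reg_mat d lam I x)"

lemma mat_inv_correct:
  assumes B: "B \<in> carrier_mat d d" and det: "det B \<noteq> 0"
  shows "mat_inv B \<in> carrier_mat d d" "B * mat_inv B = 1\<^sub>m d"
proof -
  from det_non_zero_imp_unit[OF B det] mat_inverse(1)[OF B]
  obtain C where "mat_inverse B = Some C" by fastforce
  with mat_inverse(2)[OF B this]
  show "mat_inv B \<in> carrier_mat d d" "B * mat_inv B = 1\<^sub>m d"
    by (auto simp: mat_inv_def)
qed

text \<open>Cramer's rule, from multiplying the adjugate by \<open>B * mat_inv B\<close>. It
  presents the entries of the inverse as rational functions of those of \<open>B\<close>, which
  gives measurability; the algebra of resolvents rests on \<open>mat_inv_correct\<close>.\<close>

lemma mat_inv_adj: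
  assumes B: "B \<in> carrier_mat d d" and det: "det B \<noteq> 0"
  shows "mat_inv B = inverse (det B) \<cdot>\<^sub>m adj_mat B"
proof -
  note inv = mat_inv_correct[OF B det] and adj = adj_mat[OF B]
  have "adj_mat B = adj_mat B * (B * mat_inv B)"
    using inv adj by simp
  also have "\<dots> = (adj_mat B * B) * mat_inv B"
    by (rule assoc_mult_mat[OF adj(1) B inv(1), symmetric])
  also have "\<dots> = det B \<cdot>\<^sub>m mat_inv B"
    using inv adj by (simp add: mult_smult_assoc_mat[OF one_carrier_mat])
  finally show ?thesis
    using inv det by (auto intro!: eq_matI)
qed

locale ridge =
  fixes d :: nat and lam :: real and I :: "'i set" and x :: "'i \<Rightarrow> real vec"
  assumes lam_pos: "lam > 0" and x_carrier: "\<And>i. i \<in> I \<Longrightarrow> x i \<in> carrier_vec d"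
begin

abbreviation "M \<equiv> reg_mat d lam I x"
abbreviation "Q \<equiv> resolvent d lam I x"

lemma M_scalar_prod:
  "u \<in> carrier_vec d \<Longrightarrow> v \<in> carrier_vec d \<Longrightarrow>
    u \<bullet> (M *\<^sub>v v) = lam * (u \<bullet> v) + (\<Sum>i\<in>I. (u \<bullet> x i) * (x i \<bullet> v))"
  by (rule reg_mat_scalar_prod) (auto intro: x_carrier)

lemma M_quad_ge: "v \<in> carrier_vec d \<Longrightarrow> lam * (v \<bullet> v) \<le> v \<bullet> (M *\<^sub>v v)"
  by (simp add: M_scalar_prod sum_nonneg comm_scalar_prod[OF x_carrier])

lemma det_M: "det M \<noteq> 0"
proof
  assume "det M = 0"
  then obtain v where v: "v \<in> carrier_vec d" "v \<noteq> 0\<^sub>v d" "M *\<^sub>v v = 0\<^sub>v d"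
    using det_0_iff_vec_prod_zero_field[OF reg_mat_carrier] by blast
  with M_quad_ge[of v] lam_pos have "v \<bullet> v = 0"
    by (simp add: mult_le_0_iff order.antisym)
  with v show False using scalar_prod_self_eq_0 by blast
qed

lemma Q_carrier [simp]: "Q \<in> carrier_mat d d"
  and M_Q: "M * Q = 1\<^sub>m d"
  unfolding resolvent_def by (rule mat_inv_correct[OF reg_mat_carrier det_M])+

lemma Q_vec_carrier [simp]: "Q *\<^sub>v v \<in> carrier_vec d"
  by (rule carrier_vecI) (simp add: carrier_matD(1)[OF Q_carrier])

lemma M_Q_vec: "v \<in> carrier_vec d \<Longrightarrow> M *\<^sub>v (Q *\<^sub>v v) = v"
  using assoc_mult_mat_vec[OF reg_mat_carrier Q_carrier] M_Q by (metis one_mult_mat_vec)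

lemma M_sym: "u \<in> carrier_vec d \<Longrightarrow> v \<in> carrier_vec d \<Longrightarrow> u \<bullet> (M *\<^sub>v v) = (M *\<^sub>v u) \<bullet> v"
  by (subst comm_scalar_prod[of "M *\<^sub>v u" d])
    (auto simp: M_scalar_prod comm_scalar_prod[of v d u] comm_scalar_prod[OF x_carrier]
      mult.commute intro!: sum.cong mult_mat_vec_carrier[OF reg_mat_carrier])

lemma Q_sym: "u \<in> carrier_vec d \<Longrightarrow> v \<in> carrier_vec d \<Longrightarrow> u \<bullet> (Q *\<^sub>v v) = (Q *\<^sub>v u) \<bullet> v"
  using M_sym[of "Q *\<^sub>v u" "Q *\<^sub>v v"] by (simp add: M_Q_vec)

text \<open>This is I = lam Q + sum of Q x_i x_i^T, read off from Q M = I. Its trace, its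
  expectation and its value at a vector of the form Q v are the identities on which the random part
  is built.\<close>

lemma Q_expand:
  assumes "u \<in> carrier_vec d" "v \<in> carrier_vec d"
  shows "u \<bullet> v = lam * (u \<bullet> (Q *\<^sub>v v)) + (\<Sum>i\<in>I. (u \<bullet> (Q *\<^sub>v x i)) * (x i \<bullet> v))"
  using M_scalar_prod[of "Q *\<^sub>v u" v] M_sym[of "Q *\<^sub>v u" v] assms
  by (simp add: M_Q_vec Q_sym x_carrier)

text \<open>The inequality lam Q^2 \<le> Q, obtained by testing M \<ge> lam at Q v. Besides |Q|
  \<le> 1/lam it yields bounds on Q x_k through x_k . Q x_k, which do not see the length of
  x_k.\<close>

lemma Q_quad_ge: "v \<in> carrier_vec d \<Longrightarrow> lam * (vec_enorm (Q *\<^sub>v v))\<^sup>2 \<le> v \<bullet> (Q *\<^sub>v v)"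
  using M_quad_ge[of "Q *\<^sub>v v"] comm_scalar_prod[of v d "Q *\<^sub>v v"] by (simp add: M_Q_vec vec_enorm_sq)

lemma Q_quad_nonneg: "v \<in> carrier_vec d \<Longrightarrow> 0 \<le> v \<bullet> (Q *\<^sub>v v)"
  using Q_quad_ge[of v] lam_pos by (meson mult_nonneg_nonneg less_imp_le order_trans zero_le_power2)

lemma Q_enorm_le:
  assumes v: "v \<in> carrier_vec d"
  shows "vec_enorm (Q *\<^sub>v v) \<le> vec_enorm v / lam"
proof (cases "vec_enorm (Q *\<^sub>v v) = 0")
  case True
  then show ?thesis using lam_pos by simp
next
  case False
  have "lam * (vec_enorm (Q *\<^sub>v v))\<^sup>2 \<le> vec_enorm v * vec_enorm (Q *\<^sub>v v)"
    using Q_quad_ge[OF v] scalar_prod_vec_enorm_le[OF v, of "Q *\<^sub>v v"] by simp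
  with False have "lam * vec_enorm (Q *\<^sub>v v) \<le> vec_enorm v"
    using vec_enorm_nonneg[of "Q *\<^sub>v v"] by (simp add: power2_eq_square less_le)
  then show ?thesis using lam_pos by (simp add: field_simps)
qed

lemma Q_bilin_le:
  assumes "u \<in> carrier_vec d" "v \<in> carrier_vec d"
  shows "\<bar>u \<bullet> (Q *\<^sub>v v)\<bar> \<le> vec_enorm u * vec_enorm v / lam"
  using scalar_prod_vec_enorm_le[of u d "Q *\<^sub>v v"] assms
    mult_left_mono[OF Q_enorm_le[of v] vec_enorm_nonneg[of u]] by simp

end

section \<open>Removing one vector: Sherman-Morrison and leave-one-out bounds\<close>

locale ridge_insert = ridge d lam "insert k I" x for d lam k and I :: "'i set" and x +
  assumes fin: "finite I" and k: "k \<notin> I"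
begin

sublocale R: ridge d lam I x
  by unfold_locales (auto simp: lam_pos x_carrier)

text \<open>The Sherman-Morrison denominator. \<open>R.Q\<close> is the resolvent without the vector
  k and \<open>Q\<close> the one with it.\<close>

definition "D = 1 + x k \<bullet> (R.Q *\<^sub>v x k)"

lemma xk [simp]: "x k \<in> carrier_vec d"
  by (simp add: x_carrier)

lemma D_ge: "1 \<le> D"
  by (simp add: D_def R.Q_quad_nonneg)

text \<open>The two regularized matrices differ by x_k x_k^T. Placing either of them between
  \<open>Q\<close> and \<open>R.Q\<close> and expanding gives the resolvent identity R.Q = Q + Q x_k
  x_k^T R.Q.\<close>

lemma rank_one_resolvent:
  assumes "u \<in> carrier_vec d" "v \<in> carrier_vec d"
  shows "u \<bullet> (R.Q *\<^sub>v v) = u \<bullet> (Q *\<^sub>v v) + (u \<bullet> (Q *\<^sub>v x k)) * (x k \<bullet> (R.Q *\<^sub>v v))"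
proof -
  have "u \<bullet> (Q *\<^sub>v v) = (Q *\<^sub>v u) \<bullet> (R.M *\<^sub>v (R.Q *\<^sub>v v))"
    using assms by (simp add: Q_sym R.M_Q_vec)
  also have "\<dots> = lam * (u \<bullet> (Q *\<^sub>v (R.Q *\<^sub>v v))) + (\<Sum>i\<in>I. (u \<bullet> (Q *\<^sub>v x i)) * (x i \<bullet> (R.Q *\<^sub>v v)))"
    using assms by (simp add: R.M_scalar_prod Q_sym R.x_carrier)
  finally show ?thesis
    using Q_expand[of u "R.Q *\<^sub>v v"] assms fin k by simp
qed

lemma Q_xk:
  assumes "u \<in> carrier_vec d"
  shows "u \<bullet> (Q *\<^sub>v x k) = u \<bullet> (R.Q *\<^sub>v x k) / D"
  using rank_one_resolvent[OF assms xk] D_ge by (simp add: D_def field_simps)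

lemma sherman_morrison:
  assumes "u \<in> carrier_vec d" "v \<in> carrier_vec d"
  shows "u \<bullet> (Q *\<^sub>v v) = u \<bullet> (R.Q *\<^sub>v v) - (u \<bullet> (R.Q *\<^sub>v x k)) * (x k \<bullet> (R.Q *\<^sub>v v)) / D"
  using rank_one_resolvent[OF assms] Q_xk[OF assms(1)] by simp

lemma one_minus_quad_xk: "1 - x k \<bullet> (Q *\<^sub>v x k) = 1 / D"
  using Q_xk[OF xk] D_ge by (simp add: D_def field_simps)

lemma quad_xk_le: "x k \<bullet> (Q *\<^sub>v x k) \<le> 1"
  using one_minus_quad_xk D_ge by (smt (verit) divide_nonneg_nonneg)

text \<open>From lam |Q x_k|^2 \<le> x_k . Q x_k \<le> 1. The length of x_k does not enter, so u . Q
  x_k stays bounded although Gaussian rows are not.\<close>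

lemma enorm_Q_xk_le: "(vec_enorm (Q *\<^sub>v x k))\<^sup>2 \<le> 1 / lam"
  using Q_quad_ge[OF xk] quad_xk_le lam_pos by (simp add: field_simps)

text \<open>By Sherman-Morrison the difference of the traces is |R.Q x_k|^2 / D, and lam |R.Q x_k|^2
  \<le> x_k . R.Q x_k \<le> D. This is the origin of the bounded difference 1/lam.\<close>

lemma trace_diff:
  "0 \<le> (\<Sum>a<d. unit_vec d a \<bullet> (R.Q *\<^sub>v unit_vec d a)) - (\<Sum>a<d. unit_vec d a \<bullet> (Q *\<^sub>v unit_vec d a))" (is "0 \<le> ?A - ?B")
  "(\<Sum>a<d. unit_vec d a \<bullet> (R.Q *\<^sub>v unit_vec d a)) - (\<Sum>a<d. unit_vec d a \<bullet> (Q *\<^sub>v unit_vec d a)) \<le> 1 / lam"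
proof -
  let ?z = "R.Q *\<^sub>v x k"
  have "?A - ?B = (\<Sum>a<d. (unit_vec d a \<bullet> ?z) * (?z \<bullet> unit_vec d a)) / D"
    by (simp add: sherman_morrison R.Q_sym[OF xk] sum_subtractf flip: sum_divide_distrib)
  also have "\<dots> = (vec_enorm ?z)\<^sup>2 / D"
    by (subst unit_vec_sum_scalar_prod) (auto simp: vec_enorm_sq)
  finally have eq: "?A - ?B = (vec_enorm ?z)\<^sup>2 / D" .
  show "0 \<le> ?A - ?B" unfolding eq using D_ge by simp
  have "lam * (vec_enorm ?z)\<^sup>2 \<le> D" using R.Q_quad_ge[OF xk] by (simp add: D_def)
  then show "?A - ?B \<le> 1 / lam"
    unfolding eq using D_ge lam_pos by (simp add: field_simps)
qed

end

section \<open>Gaussian integration by parts and bounded differences\<close>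

lemma normal_density_at_infinity:
  assumes "\<sigma> > 0"
  shows "(normal_density 0 \<sigma> \<longlongrightarrow> 0) at_top" "(normal_density 0 \<sigma> \<longlongrightarrow> 0) at_bot"
  unfolding normal_density_def using assms by real_asymp+

text \<open>The derivative of p f, with p the density, is integrated over the real line: p' = - s p
  / \<sigma>^2, and the boundary terms vanish because f is bounded.\<close>

lemma stein_normal:
  fixes f f' :: "real \<Rightarrow> real"
  assumes \<sigma>: "\<sigma> > 0"
    and deriv: "\<And>s. (f has_real_derivative f' s) (at s)"
    and cont: "\<And>s. isCont f' s"
    and f_le: "\<And>s. \<bar>f s\<bar> \<le> C" and f'_le: "\<And>s. \<bar>f' s\<bar> \<le> C"
  shows "(\<integral>s. s * f s \<partial>density lborel (normal_density 0 \<sigma>))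
       = \<sigma>\<^sup>2 * (\<integral>s. f' s \<partial>density lborel (normal_density 0 \<sigma>))"
proof -
  let ?p = "normal_density 0 \<sigma>"
  have f_cont: "isCont f s" for s
    using deriv by (rule DERIV_isCont)
  have [measurable]: "f \<in> borel_measurable borel" "f' \<in> borel_measurable borel"
    using f_cont cont by (auto intro!: borel_measurable_continuous_onI simp: continuous_on_eq_continuous_at)
  have p_deriv: "(?p has_real_derivative (- s / \<sigma>\<^sup>2 * ?p s)) (at s)" for s
    unfolding normal_density_def using \<sigma>
    by (auto intro!: derivative_eq_intros simp: field_simps)
  have int1: "integrable lborel (\<lambda>s. ?p s * f' s)"
  proof (rule Bochner_Integration.integrable_bound[of _ "\<lambda>s. C * ?p s"])
    have "\<bar>f' s\<bar> * ?p s \<le> \<bar>C\<bar> * ?p s" for s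
      using f'_le[of s] by (intro mult_right_mono) auto
    then show "AE s in lborel. norm (?p s * f' s) \<le> norm (C * ?p s)"
      by (auto simp: abs_mult mult_ac)
  qed (use \<sigma> in auto)
  have int2: "integrable lborel (\<lambda>s. ?p s * (s * f s))"
  proof (rule Bochner_Integration.integrable_bound[of _ "\<lambda>s. C * (?p s * s)"])
    have "\<bar>f s\<bar> * (?p s * \<bar>s\<bar>) \<le> \<bar>C\<bar> * (?p s * \<bar>s\<bar>)" for s
      using f_le[of s] by (intro mult_right_mono) auto
    then show "AE s in lborel. norm (?p s * (s * f s)) \<le> norm (C * (?p s * s))"
      by (auto simp: abs_mult mult_ac)
  qed (use \<sigma> integrable_normal_moment_nz_1 in auto)
  let ?F = "\<lambda>s. ?p s * f s" and ?f = "\<lambda>s. ?p s * f' s - ?p s * (s * f s) / \<sigma>\<^sup>2"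
  have lim: "(?F \<longlongrightarrow> 0) at_top" "(?F \<longlongrightarrow> 0) at_bot"
  proof -
    have le: "\<bar>f s\<bar> * ?p s \<le> C * ?p s" for s
      by (intro mult_right_mono f_le) auto
    show "(?F \<longlongrightarrow> 0) at_top"
      by (rule Lim_null_comparison[of _ "\<lambda>s. C * ?p s"])
         (use le normal_density_at_infinity[OF \<sigma>] in \<open>auto simp: abs_mult mult.commute intro!: tendsto_mult_right_zero\<close>)
    show "(?F \<longlongrightarrow> 0) at_bot"
      by (rule Lim_null_comparison[of _ "\<lambda>s. C * ?p s"])
         (use le normal_density_at_infinity[OF \<sigma>] in \<open>auto simp: abs_mult mult.commute intro!: tendsto_mult_right_zero\<close>)
  qed
  have "(LBINT s=-\<infinity>..\<infinity>. ?f s) = 0 - 0"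
  proof (rule interval_integral_FTC_integrable)
    show "(?F has_vector_derivative ?f s) (at s)" for s
      unfolding has_real_derivative_iff_has_vector_derivative[symmetric] using \<sigma>
      by (auto intro!: derivative_eq_intros deriv p_deriv simp: field_simps)
    show "isCont ?f s" for s
      by (intro continuous_intros cont f_cont DERIV_isCont[OF p_deriv]) (use \<sigma> in auto)
    show "set_integrable lborel (einterval (- \<infinity>) \<infinity>) ?f"
      using int1 int2 by (simp add: set_integrable_def)
    show "((?F \<circ> real_of_ereal) \<longlongrightarrow> 0) (at_right (- \<infinity>))" "((?F \<circ> real_of_ereal) \<longlongrightarrow> 0) (at_left \<infinity>)"
      using lim by (simp_all add: ereal_tendsto_simps)
  qed simp
  then have "(\<integral>s. ?f s \<partial>lborel) = 0"
    by (simp add: interval_integral_to_infinity_eq interval_lebesgue_integral_def set_lebesgue_integral_def)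
  moreover have "(\<integral>s. ?f s \<partial>lborel) = (\<integral>s. ?p s * f' s \<partial>lborel) - (\<integral>s. ?p s * (s * f s) \<partial>lborel) / \<sigma>\<^sup>2"
    using int1 int2 by simp
  ultimately have "(\<integral>s. ?p s * (s * f s) \<partial>lborel) / \<sigma>\<^sup>2 = (\<integral>s. ?p s * f' s \<partial>lborel)"
    by linarith
  then have "(\<integral>s. ?p s * (s * f s) \<partial>lborel) = \<sigma>\<^sup>2 * (\<integral>s. ?p s * f' s \<partial>lborel)"
    using \<sigma> by (simp only: divide_eq_eq mult.commute) (simp split: if_splits)
  then show ?thesis
    by (simp add: integral_density)
qed

lemma (in product_prob_space) integrable_component:
  fixes h :: "'a \<Rightarrow> real"
  assumes "finite I" "p \<in> I" "integrable (M p) h"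
  shows "integrable (PiM I M) (\<lambda>\<omega>. h (\<omega> p))"
proof -
  have "distr (PiM I M) (M p) (\<lambda>\<omega>. \<omega> p) = M p"
    using distr_PiM_component[of I M p] assms M.prob_space_axioms prob_space by metis
  then show ?thesis
    using integrable_distr[of "\<lambda>\<omega>. \<omega> p" "PiM I M" "M p" h] assms
    by (simp add: measurable_component_singleton)
qed

text \<open>Fubini isolates the coordinate p, and the one-dimensional formula applies on each line
  in that direction. The constant C bounds both F and its partial derivative G, so every integral
  converges absolutely.\<close>

lemma stein_PiM_normal:
  fixes F G :: "('i \<Rightarrow> real) \<Rightarrow> real" and \<sigma> :: real
  defines "N \<equiv> density lborel (normal_density 0 \<sigma>)"
  assumes \<sigma>: "\<sigma> > 0" and fin: "finite I" and p: "p \<in> I"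
    and [measurable]: "F \<in> borel_measurable (PiM I (\<lambda>_. N))" "G \<in> borel_measurable (PiM I (\<lambda>_. N))"
    and F_le: "\<And>\<omega>. \<bar>F \<omega>\<bar> \<le> C" and G_le: "\<And>\<omega>. \<bar>G \<omega>\<bar> \<le> C"
    and deriv: "\<And>\<omega> s. ((\<lambda>s. F (fun_upd \<omega> p s)) has_real_derivative G (fun_upd \<omega> p s)) (at s)"
    and cont: "\<And>\<omega> s. isCont (\<lambda>s. G (fun_upd \<omega> p s)) s"
  shows "integrable (PiM I (\<lambda>_. N)) (\<lambda>\<omega>. \<omega> p * F \<omega>)"
    and "(\<integral>\<omega>. \<omega> p * F \<omega> \<partial>PiM I (\<lambda>_. N)) = \<sigma>\<^sup>2 * (\<integral>\<omega>. G \<omega> \<partial>PiM I (\<lambda>_. N))"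
proof -
  interpret N: prob_space N
    unfolding N_def using \<sigma> by (rule prob_space_normal_density)
  interpret product_prob_space "\<lambda>_. N" I
    by unfold_locales
  interpret P: prob_space "PiM I (\<lambda>_. N)"
    by (rule prob_space_PiM) (rule N.prob_space_axioms)
  have [measurable_cong]: "sets N = sets borel" by (simp add: N_def)
  have "integrable N (\<lambda>s. s)"
    using integrable_normal_moment_nz_1[OF \<sigma>, of 0] \<sigma> by (simp add: N_def integrable_density)
  then have "integrable (PiM I (\<lambda>_. N)) (\<lambda>\<omega>. \<omega> p)"
    by (rule integrable_component[OF fin p])
  then have "integrable (PiM I (\<lambda>_. N)) (\<lambda>\<omega>. C * \<omega> p)" by simp
  then show int: "integrable (PiM I (\<lambda>_. N)) (\<lambda>\<omega>. \<omega> p * F \<omega>)"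
  proof (rule Bochner_Integration.integrable_bound)
    have "\<bar>F \<omega>\<bar> * \<bar>\<omega> p\<bar> \<le> \<bar>C\<bar> * \<bar>\<omega> p\<bar>" for \<omega>
      using F_le[of \<omega>] by (intro mult_right_mono) auto
    then show "AE \<omega> in PiM I (\<lambda>_. N). norm (\<omega> p * F \<omega>) \<le> norm (C * \<omega> p)"
      by (auto simp: abs_mult mult_ac)
  qed (use p in measurable)
  have intG: "integrable (PiM I (\<lambda>_. N)) G"
    by (rule P.integrable_const_bound[of _ C]) (use G_le in auto)
  have I: "I = insert p (I - {p})" "finite (I - {p})" "p \<notin> I - {p}"
    using p fin by auto
  have "(\<integral>\<omega>. \<omega> p * F \<omega> \<partial>PiM I (\<lambda>_. N))
      = (\<integral>\<omega>. (\<integral>s. s * F (fun_upd \<omega> p s) \<partial>N) \<partial>PiM (I - {p}) (\<lambda>_. N))"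
    using product_integral_insert[OF I(2,3), of "\<lambda>\<omega>. \<omega> p * F \<omega>"] int I(1) by simp
  also have "\<dots> = (\<integral>\<omega>. \<sigma>\<^sup>2 * (\<integral>s. G (fun_upd \<omega> p s) \<partial>N) \<partial>PiM (I - {p}) (\<lambda>_. N))"
    unfolding N_def using deriv cont F_le G_le
    by (intro Bochner_Integration.integral_cong refl stein_normal[OF \<sigma>, where C = C])
  also have "\<dots> = \<sigma>\<^sup>2 * (\<integral>\<omega>. G \<omega> \<partial>PiM I (\<lambda>_. N))"
    using product_integral_insert[OF I(2,3), of G] intG I(1) by simp
  finally show "(\<integral>\<omega>. \<omega> p * F \<omega> \<partial>PiM I (\<lambda>_. N)) = \<sigma>\<^sup>2 * (\<integral>\<omega>. G \<omega> \<partial>PiM I (\<lambda>_. N))" .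
qed

text \<open>Every value of X lies within c of the mean, so the variance is at most c^2. Keeping the
  second moment on the left gives the form that iterates: block after block, the square of a
  function is replaced by c^2 plus the square of its average.\<close>

lemma (in prob_space) second_moment_le_of_diff_le:
  fixes X :: "'a \<Rightarrow> real"
  assumes X: "X \<in> borel_measurable M" and le: "\<And>\<omega>. \<omega> \<in> space M \<Longrightarrow> \<bar>X \<omega>\<bar> \<le> C"
    and diff: "\<And>\<omega> \<omega>'. \<omega> \<in> space M \<Longrightarrow> \<omega>' \<in> space M \<Longrightarrow> \<bar>X \<omega> - X \<omega>'\<bar> \<le> c"
  shows "expectation (\<lambda>\<omega>. (X \<omega>)\<^sup>2) \<le> c\<^sup>2 + (expectation X)\<^sup>2"
proof -
  have int: "integrable M X"
    by (rule integrable_const_bound[of _ C]) (use X le in auto)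
  have int2: "integrable M (\<lambda>\<omega>. (X \<omega>)\<^sup>2)"
    by (rule integrable_const_bound[of _ "C\<^sup>2"])
       (use X le in \<open>auto simp: abs_le_square_iff[symmetric] intro!: AE_I2 intro: order_trans[OF _ abs_ge_self]\<close>)
  have le_c: "\<bar>X \<omega> - expectation X\<bar> \<le> c" if \<omega>: "\<omega> \<in> space M" for \<omega>
  proof -
    have "X \<omega>' \<le> X \<omega> + c" "X \<omega> - c \<le> X \<omega>'" if "\<omega>' \<in> space M" for \<omega>'
      using diff[OF \<omega> that] by linarith+
    then have "expectation X \<le> expectation (\<lambda>_. X \<omega> + c)" "expectation (\<lambda>_. X \<omega> - c) \<le> expectation X"
      using int by (intro integral_mono; simp)+
    then show ?thesis by (simp add: prob_space abs_le_iff)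
  qed
  have "variance X \<le> expectation (\<lambda>_. c\<^sup>2)"
  proof (rule integral_mono)
    show "integrable M (\<lambda>\<omega>. (X \<omega> - expectation X)\<^sup>2)"
      using int int2 by (simp add: power2_diff)
    show "(X \<omega> - expectation X)\<^sup>2 \<le> c\<^sup>2" if "\<omega> \<in> space M" for \<omega>
      using le_c[OF that] by (metis abs_ge_zero power2_abs power_mono)
  qed simp
  then show ?thesis
    using variance_eq[OF int int2] by (simp add: prob_space)
qed

text \<open>Efron--Stein with bounded differences. The coordinates are grouped into blocks because the
  bound pays $c^2$ per block: treating the entries of a Gaussian matrix one by one instead of row by
  row would lose a factor $n$.\<close>
lemma variance_bounded_differences:
  fixes f :: "('i \<Rightarrow> 'b) \<Rightarrow> real"
  assumes prob: "\<And>i. prob_space (M i)"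
    and fin: "finite L" "\<And>l. l \<in> L \<Longrightarrow> finite (K l)"
    and disj: "disjoint_family_on K L"
    and f: "f \<in> borel_measurable (PiM (\<Union>l\<in>L. K l) M)"
    and le: "\<And>\<omega>. \<omega> \<in> space (PiM (\<Union>l\<in>L. K l) M) \<Longrightarrow> \<bar>f \<omega>\<bar> \<le> C"
    and diff: "\<And>l \<omega> \<omega>'. l \<in> L \<Longrightarrow> \<omega> \<in> space (PiM (\<Union>l\<in>L. K l) M) \<Longrightarrow> \<omega>' \<in> space (PiM (\<Union>l\<in>L. K l) M) \<Longrightarrow> (\<And>i. i \<notin> K l \<Longrightarrow> \<omega> i = \<omega>' i) \<Longrightarrow> \<bar>f \<omega> - f \<omega>'\<bar> \<le> c"
  shows "(\<integral>\<omega>. (f \<omega>)\<^sup>2 \<partial>PiM (\<Union>l\<in>L. K l) M)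
     \<le> real (card L) * c\<^sup>2 + (\<integral>\<omega>. f \<omega> \<partial>PiM (\<Union>l\<in>L. K l) M)\<^sup>2"
  using fin disj f le diff
proof (induction L arbitrary: f rule: finite_induct)
  case empty
  show ?case by (simp add: PiM_empty lebesgue_integral_count_space_finite)
next
  case (insert l L)
  let ?I = "\<Union>l\<in>L. K l" and ?J = "K l"
  interpret IJ: prob_space "PiM (?I \<union> ?J) M" by (intro prob_space_PiM prob)
  interpret product_prob_space M "?I \<union> ?J"
    by (rule product_prob_spaceI) (rule prob)
  interpret I: prob_space "PiM ?I M" by (intro prob_space_PiM prob)
  interpret J: prob_space "PiM ?J M" by (intro prob_space_PiM prob)
  have IJ: "?I \<inter> ?J = {}" "finite ?I" "finite ?J"
    using insert.prems(1,2) insert.hyps by (auto simp: disjoint_family_on_insert)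
  have U: "(\<Union>l\<in>insert l L. K l) = ?I \<union> ?J" by auto
  note prems = insert.prems(3-)[unfolded U]
  have f[measurable]: "f \<in> borel_measurable (PiM (?I \<union> ?J) M)"
    by (rule prems(1))
  have merge_space: "merge ?I ?J (\<omega>, \<omega>') \<in> space (PiM (?I \<union> ?J) M)"
    if "\<omega> \<in> space (PiM ?I M)" "\<omega>' \<in> space (PiM ?J M)" for \<omega> \<omega>'
    using measurable_space[OF measurable_merge[of ?I ?J M], of "(\<omega>, \<omega>')"] that
    by (simp add: space_pair_measure)
  have sq_le: "(f \<omega>)\<^sup>2 \<le> C\<^sup>2" if "\<omega> \<in> space (PiM (?I \<union> ?J) M)" for \<omega>
    using prems(2)[OF that] by (metis abs_ge_zero power2_abs power_mono)
  have intf: "integrable (PiM (?I \<union> ?J) M) f"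
    by (rule IJ.integrable_const_bound[of _ C]) (use prems(2) in auto)
  have intf2: "integrable (PiM (?I \<union> ?J) M) (\<lambda>\<omega>. (f \<omega>)\<^sup>2)"
    by (rule IJ.integrable_const_bound[of _ "C\<^sup>2"]) (use sq_le in auto)
  \<comment> \<open>\<open>g\<close> averages over the block l and \<open>h\<close> is the second
    moment over it, so \<open>h\<close> is at most c^2 + g^2 pointwise. The average inherits the
    bound C and the bounded differences in the remaining blocks, so the induction hypothesis applies
    to \<open>g\<close>.\<close>
  define g where "g \<omega> = (\<integral>\<omega>'. f (merge ?I ?J (\<omega>, \<omega>')) \<partial>PiM ?J M)" for \<omega>
  define h where "h \<omega> = (\<integral>\<omega>'. (f (merge ?I ?J (\<omega>, \<omega>')))\<^sup>2 \<partial>PiM ?J M)" for \<omega>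
  have fm[measurable]: "(\<lambda>p. f (merge ?I ?J p)) \<in> borel_measurable (PiM ?I M \<Otimes>\<^sub>M PiM ?J M)"
    by measurable
  have fm1: "(\<lambda>\<omega>'. f (merge ?I ?J (\<omega>, \<omega>'))) \<in> borel_measurable (PiM ?J M)"
    if "\<omega> \<in> space (PiM ?I M)" for \<omega>
    using measurable_compose_Pair1[OF that fm] .
  have gm[measurable]: "g \<in> borel_measurable (PiM ?I M)"
    unfolding g_def by (rule J.borel_measurable_lebesgue_integral) (use fm in simp)
  have hm[measurable]: "h \<in> borel_measurable (PiM ?I M)"
    unfolding h_def by (rule J.borel_measurable_lebesgue_integral) (use fm in simp)
  have int_m: "integrable (PiM ?J M) (\<lambda>\<omega>'. f (merge ?I ?J (\<omega>, \<omega>')))"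
    if "\<omega> \<in> space (PiM ?I M)" for \<omega>
    by (rule J.integrable_const_bound[of _ C]) (use prems(2) merge_space that fm1 in auto)
  have g_le: "\<bar>g \<omega>\<bar> \<le> C" if \<omega>: "\<omega> \<in> space (PiM ?I M)" for \<omega>
  proof -
    have "\<bar>g \<omega>\<bar> \<le> (\<integral>\<omega>'. \<bar>f (merge ?I ?J (\<omega>, \<omega>'))\<bar> \<partial>PiM ?J M)"
      unfolding g_def by (rule integral_abs_bound)
    also have "\<dots> \<le> (\<integral>\<omega>'. C \<partial>PiM ?J M)"
      by (intro integral_mono) (use int_m prems(2) merge_space \<omega> in auto)
    finally show ?thesis by (simp add: J.prob_space)
  qed
  have h_le: "h \<omega> \<le> c\<^sup>2 + (g \<omega>)\<^sup>2" if \<omega>: "\<omega> \<in> space (PiM ?I M)" for \<omega>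
    unfolding h_def g_def
  proof (rule J.second_moment_le_of_diff_le[of _ C])
    show "\<bar>f (merge ?I ?J (\<omega>, \<omega>1)) - f (merge ?I ?J (\<omega>, \<omega>2))\<bar> \<le> c"
      if "\<omega>1 \<in> space (PiM ?J M)" "\<omega>2 \<in> space (PiM ?J M)" for \<omega>1 \<omega>2
      by (rule prems(3)[of l]) (use that \<omega> merge_space in \<open>auto simp: merge_def\<close>)
  qed (use \<omega> fm1 prems(2) merge_space in auto)
  have h_ge: "0 \<le> h \<omega>" for \<omega> unfolding h_def by simp
  have g2_le: "(g \<omega>)\<^sup>2 \<le> C\<^sup>2" if "\<omega> \<in> space (PiM ?I M)" for \<omega>
    using g_le[OF that] by (metis abs_ge_zero power2_abs power_mono)
  have int_g2: "integrable (PiM ?I M) (\<lambda>\<omega>. (g \<omega>)\<^sup>2)"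
    by (rule I.integrable_const_bound[of _ "C\<^sup>2"]) (use g2_le in auto)
  have "(\<integral>\<omega>. (f \<omega>)\<^sup>2 \<partial>PiM (?I \<union> ?J) M) = (\<integral>\<omega>. h \<omega> \<partial>PiM ?I M)"
    unfolding h_def by (rule product_integral_fold[OF IJ intf2])
  also have "\<dots> \<le> (\<integral>\<omega>. c\<^sup>2 + (g \<omega>)\<^sup>2 \<partial>PiM ?I M)"
  proof (rule integral_mono)
    have "h \<omega> \<le> c\<^sup>2 + C\<^sup>2" if "\<omega> \<in> space (PiM ?I M)" for \<omega>
      using h_le[OF that] g2_le[OF that] by linarith
    then show "integrable (PiM ?I M) h"
      by (intro I.integrable_const_bound[of _ "c\<^sup>2 + C\<^sup>2"]) (use h_ge in auto)
  qed (use int_g2 h_le in auto)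
  also have "\<dots> = c\<^sup>2 + (\<integral>\<omega>. (g \<omega>)\<^sup>2 \<partial>PiM ?I M)"
    using int_g2 by (simp add: I.prob_space)
  also have "(\<integral>\<omega>. (g \<omega>)\<^sup>2 \<partial>PiM ?I M) \<le> real (card L) * c\<^sup>2 + (\<integral>\<omega>. g \<omega> \<partial>PiM ?I M)\<^sup>2"
  proof (rule insert.IH)
    show "\<bar>g \<omega>1 - g \<omega>2\<bar> \<le> c" if l': "l' \<in> L" and \<omega>: "\<omega>1 \<in> space (PiM ?I M)" "\<omega>2 \<in> space (PiM ?I M)"
      and eq: "\<And>i. i \<notin> K l' \<Longrightarrow> \<omega>1 i = \<omega>2 i" for l' \<omega>1 \<omega>2
    proof -
      have le: "\<bar>f (merge ?I ?J (\<omega>1, \<omega>)) - f (merge ?I ?J (\<omega>2, \<omega>))\<bar> \<le> c"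
        if "\<omega> \<in> space (PiM ?J M)" for \<omega>
        by (rule prems(3)[of l']) (use l' \<omega> eq that merge_space in \<open>auto simp: merge_def\<close>)
      have "\<bar>g \<omega>1 - g \<omega>2\<bar> \<le> (\<integral>\<omega>. \<bar>f (merge ?I ?J (\<omega>1, \<omega>)) - f (merge ?I ?J (\<omega>2, \<omega>))\<bar> \<partial>PiM ?J M)"
        unfolding g_def using int_m \<omega> by (simp flip: Bochner_Integration.integral_diff)
      also have "\<dots> \<le> (\<integral>\<omega>. c \<partial>PiM ?J M)"
        using int_m \<omega> le by (intro integral_mono) auto
      finally show ?thesis by (simp add: J.prob_space)
    qed
  qed (use insert.prems(1,2) gm g_le in \<open>auto simp: disjoint_family_on_def\<close>)
  also have "(\<integral>\<omega>. g \<omega> \<partial>PiM ?I M) = (\<integral>\<omega>. f \<omega> \<partial>PiM (?I \<union> ?J) M)"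
    unfolding g_def by (rule product_integral_fold[OF IJ intf, symmetric])
  finally show ?case
    unfolding U using insert.hyps by (simp add: algebra_simps)
qed

section \<open>The resolvent of a Gaussian sample covariance matrix\<close>

lemma borel_measurable_det:
  fixes X :: "'a \<Rightarrow> real mat"
  assumes X: "\<And>\<omega>. X \<omega> \<in> carrier_mat k k"
    and meas: "\<And>i j. i < k \<Longrightarrow> j < k \<Longrightarrow> (\<lambda>\<omega>. X \<omega> $$ (i, j)) \<in> borel_measurable N"
  shows "(\<lambda>\<omega>. det (X \<omega>)) \<in> borel_measurable N"
  unfolding det_def'[OF X]
  by (intro borel_measurable_sum borel_measurable_times borel_measurable_prod borel_measurable_const meas)
     (auto dest: permutes_in_image)

lemma borel_measurable_mat_inv:
  fixes X :: "'a \<Rightarrow> real mat"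
  assumes X: "\<And>\<omega>. X \<omega> \<in> carrier_mat k k" and det: "\<And>\<omega>. det (X \<omega>) \<noteq> 0"
    and meas: "\<And>i j. i < k \<Longrightarrow> j < k \<Longrightarrow> (\<lambda>\<omega>. X \<omega> $$ (i, j)) \<in> borel_measurable N"
    and ij: "i < k" "j < k"
  shows "(\<lambda>\<omega>. mat_inv (X \<omega>) $$ (i, j)) \<in> borel_measurable N"
proof -
  have dims: "dim_row (X \<omega>) = k" "dim_col (X \<omega>) = k" for \<omega> using X by auto
  have [measurable]: "(\<lambda>\<omega>. det (X \<omega>)) \<in> borel_measurable N"
    by (rule borel_measurable_det[OF X meas])
  have [measurable]: "(\<lambda>\<omega>. det (mat_delete (X \<omega>) j i)) \<in> borel_measurable N"
    by (rule borel_measurable_det[where k = "k - 1"])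
       (use ij in \<open>auto simp: mat_delete_def dims intro!: meas\<close>)
  show ?thesis
    using ij adj_mat(1)[OF X] by (simp add: mat_inv_adj[OF X det] adj_mat_def cofactor_def dims)
qed

lemma scalar_prod_mult_mat_vec:
  assumes "u \<in> carrier_vec d" "B \<in> carrier_mat d d" "v \<in> carrier_vec d"
  shows "u \<bullet> (B *\<^sub>v v) = (\<Sum>a<d. \<Sum>b<d. u $ a * B $$ (a, b) * v $ b)"
  using assms by (simp add: scalar_prod_def atLeast0LessThan sum_distrib_left mult.assoc)

lemma integral_double_sum:
  fixes f :: "nat \<Rightarrow> nat \<Rightarrow> 'a \<Rightarrow> real"
  assumes int: "\<And>i j. i < m \<Longrightarrow> j < n \<Longrightarrow> integrable N (f i j)"
  shows "(\<integral>\<omega>. (\<Sum>i<m. \<Sum>j<n. f i j \<omega> * c j) \<partial>N) = (\<Sum>i<m. \<Sum>j<n. (\<integral>\<omega>. f i j \<omega> \<partial>N) * c j)"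
proof -
  have int': "integrable N (\<lambda>\<omega>. f i j \<omega> * c j)" if "i < m" "j < n" for i j
    using int[OF that] by (rule integrable_mult_left)
  have "(\<integral>\<omega>. (\<Sum>i<m. \<Sum>j<n. f i j \<omega> * c j) \<partial>N) = (\<Sum>i<m. \<integral>\<omega>. (\<Sum>j<n. f i j \<omega> * c j) \<partial>N)"
    by (rule Bochner_Integration.integral_sum) (intro Bochner_Integration.integrable_sum int'; simp)
  also have "\<dots> = (\<Sum>i<m. \<Sum>j<n. \<integral>\<omega>. f i j \<omega> * c j \<partial>N)"
    by (intro sum.cong refl Bochner_Integration.integral_sum int'; simp)
  finally show ?thesis by simp
qed

text \<open>Row i of S times the matrix with rows b_j; in the application these are the rows of
  sqrt(\<gamma>/n) A. It is defined for every \<omega>, so the deterministic resolvent bounds hold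
  for each sample without side conditions.\<close>

definition sample_row ::
    "nat \<Rightarrow> nat \<Rightarrow> (nat \<Rightarrow> real vec) \<Rightarrow> (nat \<times> nat \<Rightarrow> real) \<Rightarrow> nat \<Rightarrow> real vec" where
  "sample_row n d b \<omega> i = vec d (\<lambda>a. \<Sum>j<n. \<omega> (i, j) * b j $ a)"

locale gauss_model =
  fixes m n d :: nat and lam :: real and b :: "nat \<Rightarrow> real vec"
  assumes m_pos: "m > 0" and lam_pos: "lam > 0" and b_carrier: "\<And>j. j < n \<Longrightarrow> b j \<in> carrier_vec d"
begin

abbreviation "x \<equiv> sample_row n d b"
lemmas x_def = sample_row_def[of n d b]

abbreviation "\<Omega> \<equiv> gauss_mat_space m n"

lemma x_carrier [simp]: "x \<omega> i \<in> carrier_vec d"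
  by (simp add: x_def)

sublocale R: ridge d lam "{..<m}" "x \<omega>" for \<omega>
  by unfold_locales (auto simp: lam_pos)

lemma ridge_insert_x: "i < m \<Longrightarrow> ridge_insert d lam i ({..<m} - {i}) (x \<omega>)"
  by unfold_locales (auto simp: lam_pos)

lemma insert_row: "i < m \<Longrightarrow> insert i ({..<m} - {i}) = {..<m}"
  by auto

lemma scalar_prod_x:
  assumes "v \<in> carrier_vec d"
  shows "v \<bullet> x \<omega> i = (\<Sum>j<n. \<omega> (i, j) * (v \<bullet> b j))"
proof -
  have "v \<bullet> x \<omega> i = (\<Sum>a<d. \<Sum>j<n. \<omega> (i, j) * (v $ a * b j $ a))"
    using assms by (simp add: scalar_prod_def x_def atLeast0LessThan sum_distrib_left mult_ac)
  also have "\<dots> = (\<Sum>j<n. \<omega> (i, j) * (\<Sum>a<d. v $ a * b j $ a))"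
    by (subst sum.swap) (simp add: sum_distrib_left)
  also have "\<dots> = (\<Sum>j<n. \<omega> (i, j) * (v \<bullet> b j))"
    by (intro sum.cong refl) (simp add: scalar_prod_def atLeast0LessThan carrier_vecD[OF b_carrier])
  finally show ?thesis .
qed

sublocale \<Omega>: prob_space \<Omega>
  unfolding gauss_mat_space_def using m_pos by (intro prob_space_PiM prob_space_normal_density) simp

lemma measurable_coord [measurable]:
  "i < m \<Longrightarrow> j < n \<Longrightarrow> (\<lambda>\<omega>. \<omega> (i, j)) \<in> borel_measurable \<Omega>"
proof -
  assume ij: "i < m" "j < n"
  have "(\<lambda>\<omega>. \<omega> (i, j)) \<in> measurable \<Omega> (density lborel (normal_density 0 (sqrt (1 / real m))))"
    unfolding gauss_mat_space_def by (rule measurable_component_singleton) (use ij in auto)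
  then show ?thesis by simp
qed

lemma measurable_x [measurable]: "i < m \<Longrightarrow> (\<lambda>\<omega>. x \<omega> i $ a) \<in> borel_measurable \<Omega>" if "a < d"
  unfolding x_def using that by (auto intro!: borel_measurable_sum borel_measurable_times measurable_coord)

lemma measurable_Q:
  assumes "i < d" "j < d"
  shows "(\<lambda>\<omega>. R.Q \<omega> $$ (i, j)) \<in> borel_measurable \<Omega>"
  unfolding resolvent_def
proof (rule borel_measurable_mat_inv[OF reg_mat_carrier R.det_M _ assms])
  show "(\<lambda>\<omega>. R.M \<omega> $$ (i, j)) \<in> borel_measurable \<Omega>" if "i < d" "j < d" for i j
    using that by (auto simp: reg_mat_def intro!: borel_measurable_add borel_measurable_sum borel_measurable_times measurable_x)
qed

lemma measurable_bilin:
  assumes "\<And>\<omega>. u \<omega> \<in> carrier_vec d" "\<And>\<omega>. v \<omega> \<in> carrier_vec d"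
    and "\<And>a. a < d \<Longrightarrow> (\<lambda>\<omega>. u \<omega> $ a) \<in> borel_measurable \<Omega>" "\<And>a. a < d \<Longrightarrow> (\<lambda>\<omega>. v \<omega> $ a) \<in> borel_measurable \<Omega>"
  shows "(\<lambda>\<omega>. u \<omega> \<bullet> (R.Q \<omega> *\<^sub>v v \<omega>)) \<in> borel_measurable \<Omega>"
  unfolding scalar_prod_mult_mat_vec[OF assms(1) R.Q_carrier assms(2)]
  using assms(3,4) measurable_Q by (auto intro!: borel_measurable_sum borel_measurable_times)

lemma measurable_Q_vec:
  assumes "v \<in> carrier_vec d" "a < d"
  shows "(\<lambda>\<omega>. (R.Q \<omega> *\<^sub>v v) $ a) \<in> borel_measurable \<Omega>"
proof -
  have eq: "(R.Q \<omega> *\<^sub>v v) $ a = unit_vec d a \<bullet> (R.Q \<omega> *\<^sub>v v)" for \<omega>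
    using assms(2) by (simp add: carrier_vecD[OF R.Q_vec_carrier] carrier_matD[OF R.Q_carrier])
  show ?thesis
    unfolding eq using assms by (intro measurable_bilin) auto
qed

lemma measurable_bilin2:
  assumes "u \<in> carrier_vec d" "v \<in> carrier_vec d"
  shows "(\<lambda>\<omega>. u \<bullet> (R.Q \<omega> *\<^sub>v (R.Q \<omega> *\<^sub>v v))) \<in> borel_measurable \<Omega>"
  using assms by (intro measurable_bilin measurable_Q_vec) auto

section \<open>Concentration of the trace of the resolvent\<close>

definition trQ :: "(nat \<times> nat \<Rightarrow> real) \<Rightarrow> real" where
  "trQ \<omega> = (\<Sum>a<d. unit_vec d a \<bullet> (R.Q \<omega> *\<^sub>v unit_vec d a))"

lemma measurable_trQ [measurable]: "trQ \<in> borel_measurable \<Omega>"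
  unfolding trQ_def[abs_def] by (intro borel_measurable_sum measurable_bilin) auto

text \<open>The trace of I = lam Q + sum of Q x_i x_i^T.\<close>

lemma trQ_eq: "(\<Sum>i<m. x \<omega> i \<bullet> (R.Q \<omega> *\<^sub>v x \<omega> i)) = real d - lam * trQ \<omega>"
proof -
  have "real d = (\<Sum>a<d. unit_vec d a \<bullet> unit_vec d a)" by simp
  also have "\<dots> = (\<Sum>a<d. lam * (unit_vec d a \<bullet> (R.Q \<omega> *\<^sub>v unit_vec d a))
       + (\<Sum>i<m. (unit_vec d a \<bullet> (R.Q \<omega> *\<^sub>v x \<omega> i)) * (x \<omega> i \<bullet> unit_vec d a)))"
    by (intro sum.cong refl R.Q_expand) auto
  also have "\<dots> = lam * trQ \<omega> + (\<Sum>i<m. \<Sum>a<d. (unit_vec d a \<bullet> (R.Q \<omega> *\<^sub>v x \<omega> i)) * (x \<omega> i \<bullet> unit_vec d a))"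
    unfolding sum.distrib trQ_def sum_distrib_left by (subst (2) sum.swap) (rule refl)
  also have "\<dots> = lam * trQ \<omega> + (\<Sum>i<m. x \<omega> i \<bullet> (R.Q \<omega> *\<^sub>v x \<omega> i))"
    by (simp only: unit_vec_sum_scalar_prod[OF R.Q_vec_carrier x_carrier] comm_scalar_prod[OF R.Q_vec_carrier x_carrier])
  finally show ?thesis by simp
qed

lemma abs_trQ_le: "\<bar>trQ \<omega>\<bar> \<le> real d / lam"
proof -
  have "\<bar>trQ \<omega>\<bar> \<le> (\<Sum>a<d. 1 / lam)"
    unfolding trQ_def
    by (rule order_trans[OF sum_abs sum_mono]) (rule order_trans[OF R.Q_bilin_le], auto)
  then show ?thesis by simp
qed

lemma resolvent_cong: "(\<And>i. i \<in> I \<Longrightarrow> f i = g i) \<Longrightarrow> resolvent d lam I f = resolvent d lam I g"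
  unfolding resolvent_def reg_mat_def by (simp cong: sum.cong)

text \<open>Samples that differ in row i only share the resolvent without that row. Both traces lie
  below its trace by at most 1/lam, on the same side, hence within 1/lam of each other.\<close>

lemma trQ_diff_le:
  assumes i: "i < m" and eq: "\<And>i' j. i' \<noteq> i \<Longrightarrow> \<omega> (i', j) = \<omega>' (i', j)"
  shows "\<bar>trQ \<omega> - trQ \<omega>'\<bar> \<le> 1 / lam"
proof -
  have "resolvent d lam ({..<m} - {i}) (x \<omega>) = resolvent d lam ({..<m} - {i}) (x \<omega>')"
    by (rule resolvent_cong) (use eq in \<open>auto simp: x_def\<close>)
  then show ?thesis
    using ridge_insert.trace_diff[OF ridge_insert_x[OF i, of \<omega>]]
      ridge_insert.trace_diff[OF ridge_insert_x[OF i, of \<omega>']] insert_row[OF i]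
    by (simp add: trQ_def abs_le_iff)
qed

lemma integrable_trQ [simp]: "integrable \<Omega> trQ"
  by (rule \<Omega>.integrable_const_bound[of _ "real d / lam"]) (auto simp: abs_trQ_le)

lemma integrable_trQ_sq: "integrable \<Omega> (\<lambda>\<omega>. (trQ \<omega>)\<^sup>2)"
proof (rule \<Omega>.integrable_const_bound[of _ "(real d / lam)\<^sup>2"])
  show "AE \<omega> in \<Omega>. norm ((trQ \<omega>)\<^sup>2) \<le> (real d / lam)\<^sup>2"
    using abs_trQ_le lam_pos by (auto simp flip: abs_le_square_iff)
qed simp

text \<open>Efron-Stein with the m rows as blocks bounds the variance by m / lam^2. The deviation
  later enters divided by m and so contributes O(m^(-1/2)).\<close>

lemma trQ_mean_deviation: "\<Omega>.expectation (\<lambda>\<omega>. \<bar>trQ \<omega> - \<Omega>.expectation trQ\<bar>) \<le> sqrt (real m) / lam"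
proof -
  let ?X = "\<lambda>\<omega>. \<bar>trQ \<omega> - \<Omega>.expectation trQ\<bar>"
  have U: "(\<Union>i\<in>{..<m}. {i} \<times> {..<n}) = {..<m} \<times> {..<n}" by auto
  have "\<Omega>.expectation (\<lambda>\<omega>. (trQ \<omega>)\<^sup>2) \<le> real (card {..<m}) * (1 / lam)\<^sup>2 + (\<Omega>.expectation trQ)\<^sup>2"
    unfolding gauss_mat_space_def U[symmetric]
  proof (rule variance_bounded_differences[where C = "real d / lam"])
    show "prob_space (density lborel (normal_density 0 (sqrt (1 / real m))))"
      using m_pos by (intro prob_space_normal_density) simp
    show "trQ \<in> borel_measurable (PiM (\<Union>i\<in>{..<m}. {i} \<times> {..<n}) (\<lambda>_. density lborel (normal_density 0 (sqrt (1 / real m)))))"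
      using measurable_trQ unfolding gauss_mat_space_def U .
    show "\<bar>trQ \<omega> - trQ \<omega>'\<bar> \<le> 1 / lam" if "i \<in> {..<m}" "\<And>p. p \<notin> {i} \<times> {..<n} \<Longrightarrow> \<omega> p = \<omega>' p" for i \<omega> \<omega>'
      using that by (intro trQ_diff_le[of i]) auto
  qed (auto simp: disjoint_family_on_def abs_trQ_le)
  then have "\<Omega>.variance trQ \<le> real m / lam\<^sup>2"
    by (subst \<Omega>.variance_eq) (auto simp: integrable_trQ_sq power_divide)
  \<comment> \<open>Nonnegativity of the variance of the absolute deviation supplies the inequality
    (E |X|)^2 \<le> E X^2.\<close>
  moreover have "0 \<le> \<Omega>.variance ?X"
    by (rule \<Omega>.variance_positive)
  moreover have "\<Omega>.variance ?X = \<Omega>.expectation (\<lambda>\<omega>. (?X \<omega>)\<^sup>2) - (\<Omega>.expectation ?X)\<^sup>2"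
    by (subst \<Omega>.variance_eq) (auto simp: integrable_trQ_sq power2_diff)
  ultimately have "(\<Omega>.expectation ?X)\<^sup>2 \<le> real m / lam\<^sup>2"
    by simp
  then have "\<Omega>.expectation ?X \<le> sqrt (real m / lam\<^sup>2)"
    by (rule real_le_rsqrt)
  then show ?thesis using lam_pos by (simp add: real_sqrt_divide)
qed

section \<open>Integration by parts in a single entry of the sketching matrix\<close>

lemma abs_Qx_le:
  assumes i: "i < m" and u: "u \<in> carrier_vec d"
  shows "\<bar>u \<bullet> (R.Q \<omega> *\<^sub>v x \<omega> i)\<bar> \<le> vec_enorm u * sqrt (1 / lam)"
proof -
  have "(vec_enorm (R.Q \<omega> *\<^sub>v x \<omega> i))\<^sup>2 \<le> 1 / lam"
    using ridge_insert.enorm_Q_xk_le[OF ridge_insert_x[OF i, of \<omega>]] insert_row[OF i] by simp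
  then have "vec_enorm (R.Q \<omega> *\<^sub>v x \<omega> i) \<le> sqrt (1 / lam)" by (rule real_le_rsqrt)
  then show ?thesis
    using scalar_prod_vec_enorm_le[OF u, of "R.Q \<omega> *\<^sub>v x \<omega> i"]
    by (meson R.Q_vec_carrier mult_left_mono order_trans vec_enorm_nonneg)
qed

text \<open>The partial derivative of u . Q x_i in the entry (i, j): that entry moves x_i in the
  direction b_j, and Q changes by - Q (b_j x_i^T + x_i b_j^T) Q.\<close>

definition G :: "real vec \<Rightarrow> nat \<Rightarrow> nat \<Rightarrow> (nat \<times> nat \<Rightarrow> real) \<Rightarrow> real" where
  "G u i j \<omega> = (u \<bullet> (R.Q \<omega> *\<^sub>v b j)) * (1 - x \<omega> i \<bullet> (R.Q \<omega> *\<^sub>v x \<omega> i))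
     - (u \<bullet> (R.Q \<omega> *\<^sub>v x \<omega> i)) * (b j \<bullet> (R.Q \<omega> *\<^sub>v x \<omega> i))"

lemma abs_G_le:
  assumes i: "i < m" and j: "j < n" and u: "u \<in> carrier_vec d"
  shows "\<bar>G u i j \<omega>\<bar> \<le> 2 * vec_enorm u * vec_enorm (b j) / lam"
proof -
  have "x \<omega> i \<bullet> (R.Q \<omega> *\<^sub>v x \<omega> i) \<le> 1"
    using ridge_insert.quad_xk_le[OF ridge_insert_x[OF i, of \<omega>]] insert_row[OF i] by simp
  then have "\<bar>1 - x \<omega> i \<bullet> (R.Q \<omega> *\<^sub>v x \<omega> i)\<bar> \<le> 1"
    using R.Q_quad_nonneg[OF x_carrier] by simp
  then have "\<bar>(u \<bullet> (R.Q \<omega> *\<^sub>v b j)) * (1 - x \<omega> i \<bullet> (R.Q \<omega> *\<^sub>v x \<omega> i))\<bar> \<le> (vec_enorm u * vec_enorm (b j) / lam) * 1"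
    unfolding abs_mult using R.Q_bilin_le[OF u b_carrier[OF j]] lam_pos by (intro mult_mono) auto
  moreover have "\<bar>(u \<bullet> (R.Q \<omega> *\<^sub>v x \<omega> i)) * (b j \<bullet> (R.Q \<omega> *\<^sub>v x \<omega> i))\<bar>
      \<le> (vec_enorm u * sqrt (1 / lam)) * (vec_enorm (b j) * sqrt (1 / lam))"
    unfolding abs_mult using abs_Qx_le[OF i] u b_carrier[OF j] lam_pos by (intro mult_mono) auto
  moreover have "(vec_enorm u * sqrt (1 / lam)) * (vec_enorm (b j) * sqrt (1 / lam)) = vec_enorm u * vec_enorm (b j) / lam"
    using lam_pos real_sqrt_mult_self[of "1 / lam"] by (simp add: algebra_simps)
  ultimately show ?thesis
    unfolding G_def by linarith
qed

text \<open>Differentiation of matrices is avoided. The resolvent without row i does not depend on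
  the entry s, and row i is affine in s, so Sherman-Morrison turns u . Q x_i into an affine function
  of s divided by a quadratic one that is at least 1.\<close>

lemma G_deriv:
  assumes i: "i < m" and j: "j < n" and u: "u \<in> carrier_vec d"
  shows "((\<lambda>s. u \<bullet> (R.Q (fun_upd \<omega> (i, j) s) *\<^sub>v x (fun_upd \<omega> (i, j) s) i)) has_real_derivative
     G u i j (fun_upd \<omega> (i, j) s)) (at s)" (is ?th1)
    and "isCont (\<lambda>s. G u i j (fun_upd \<omega> (i, j) s)) s" (is ?th2)
proof -
  define y where "y s = fun_upd \<omega> (i, j) s" for s
  interpret P: ridge d lam "{..<m} - {i}" "x \<omega>"
    by unfold_locales (auto simp: lam_pos)
  \<comment> \<open>The row at s = 0, so that row i is x0 + s b_j for general s.\<close>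
  define x0 where "x0 = x (y 0) i"
  note [simp] = b_carrier[OF j] u
  have [simp]: "x0 \<in> carrier_vec d" by (simp add: x0_def)
  have P: "resolvent d lam ({..<m} - {i}) (x (y s)) = P.Q" for s
    by (rule resolvent_cong) (auto simp: x_def y_def)
  have x: "v \<bullet> x (y s) i = v \<bullet> x0 + s * (v \<bullet> b j)" if "v \<in> carrier_vec d" for v s
  proof -
    have "(\<Sum>j'<n. y s (i, j') * (v \<bullet> b j')) = (\<Sum>j'<n. y 0 (i, j') * (v \<bullet> b j') + (if j' = j then s * (v \<bullet> b j) else 0))"
      by (intro sum.cong refl) (auto simp: y_def)
    also have "\<dots> = (\<Sum>j'<n. y 0 (i, j') * (v \<bullet> b j')) + s * (v \<bullet> b j)"
      using j by (simp add: sum.distrib)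
    finally show ?thesis using that by (simp add: scalar_prod_x x0_def)
  qed
  define \<alpha> \<beta> c0 c1 c2 where defs: "\<alpha> = u \<bullet> (P.Q *\<^sub>v x0)" "\<beta> = u \<bullet> (P.Q *\<^sub>v b j)"
    "c0 = x0 \<bullet> (P.Q *\<^sub>v x0)" "c1 = b j \<bullet> (P.Q *\<^sub>v x0)" "c2 = b j \<bullet> (P.Q *\<^sub>v b j)"
  define D where "D s = 1 + (c0 + 2 * c1 * s + c2 * s\<^sup>2)" for s
  have lin: "v \<bullet> (P.Q *\<^sub>v x (y s) i) = v \<bullet> (P.Q *\<^sub>v x0) + s * (v \<bullet> (P.Q *\<^sub>v b j))" if "v \<in> carrier_vec d" for v s
    using that by (simp add: P.Q_sym x)
  have lin': "x (y s) i \<bullet> (P.Q *\<^sub>v v) = v \<bullet> (P.Q *\<^sub>v x0) + s * (v \<bullet> (P.Q *\<^sub>v b j))" if "v \<in> carrier_vec d" for v s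
    using that lin[OF that, of s] by (subst comm_scalar_prod[of _ d]) (simp_all add: P.Q_sym)
  have comm: "x0 \<bullet> (P.Q *\<^sub>v b j) = c1"
    unfolding defs by (subst comm_scalar_prod[of _ d]) (simp_all add: P.Q_sym)
  have D: "ridge_insert.D d lam i ({..<m} - {i}) (x (y s)) = D s" for s
    unfolding ridge_insert.D_def[OF ridge_insert_x[OF i]] D_def P
    by (simp add: lin' lin comm) (simp add: defs power2_eq_square algebra_simps)
  have D_ge: "D s \<ge> 1" for s
    using ridge_insert.D_ge[OF ridge_insert_x[OF i, of "y s"]] unfolding D .
  note ri = insert_row[OF i]
  have F: "v \<bullet> (R.Q (y s) *\<^sub>v x (y s) i) = (v \<bullet> (P.Q *\<^sub>v x0) + s * (v \<bullet> (P.Q *\<^sub>v b j))) / D s"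
    if "v \<in> carrier_vec d" for v s
    using ridge_insert.Q_xk[OF ridge_insert_x[OF i, of "y s"] that] that unfolding D ri P by (simp add: lin)
  have SM: "u \<bullet> (R.Q (y s) *\<^sub>v b j) = \<beta> - (\<alpha> + s * \<beta>) * (c1 + s * c2) / D s" for s
    using ridge_insert.sherman_morrison[OF ridge_insert_x[OF i, of "y s"], of u "b j"] unfolding D ri P
    by (simp add: lin lin') (simp add: defs)
  have one: "1 - x (y s) i \<bullet> (R.Q (y s) *\<^sub>v x (y s) i) = 1 / D s" for s
    using ridge_insert.one_minus_quad_xk[OF ridge_insert_x[OF i, of "y s"]] unfolding D ri .
  \<comment> \<open>The leave-one-out expressions turn \<open>G\<close> into the quotient-rule
    derivative of (\<alpha> + s \<beta>) / \<open>D s\<close>, because D has derivative 2 (c1 + s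
    c2).\<close>
  have G: "G u i j (y s) = \<beta> / D s - 2 * (\<alpha> + s * \<beta>) * (c1 + s * c2) / (D s)\<^sup>2" for s
    unfolding G_def one SM using D_ge[of s]
    by (simp add: F) (simp add: field_simps power2_eq_square flip: defs)
  have F': "(\<lambda>s. u \<bullet> (R.Q (y s) *\<^sub>v x (y s) i)) = (\<lambda>s. (\<alpha> + s * \<beta>) / D s)"
    by (auto simp: F defs)
  have D_deriv: "(D has_real_derivative (2 * (c1 + s * c2))) (at s)" for s
    unfolding D_def[abs_def] by (auto intro!: derivative_eq_intros)
  have "((\<lambda>s. (\<alpha> + s * \<beta>) / D s) has_real_derivative G u i j (y s)) (at s)"
    unfolding G using D_ge[of s]
    by (auto intro!: derivative_eq_intros D_deriv simp: field_simps power2_eq_square)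
  then show ?th1 unfolding F'[symmetric] y_def .
  have "isCont (\<lambda>s. \<beta> / D s - 2 * (\<alpha> + s * \<beta>) * (c1 + s * c2) / (D s)\<^sup>2) s"
    using D_ge[of s] by (intro continuous_intros DERIV_isCont[OF D_deriv]) auto
  then show ?th2 unfolding G[symmetric] y_def .
qed

lemma integrable_bilin:
  assumes "u \<in> carrier_vec d" "v \<in> carrier_vec d"
  shows "integrable \<Omega> (\<lambda>\<omega>. u \<bullet> (R.Q \<omega> *\<^sub>v v))"
  by (rule \<Omega>.integrable_const_bound[of _ "vec_enorm u * vec_enorm v / lam"])
     (use assms R.Q_bilin_le in \<open>auto intro!: measurable_bilin\<close>)

lemma measurable_G:
  assumes "i < m" "j < n" "u \<in> carrier_vec d"
  shows "G u i j \<in> borel_measurable \<Omega>"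
  unfolding G_def[abs_def] using assms b_carrier[OF assms(2)]
  by (intro borel_measurable_diff borel_measurable_times measurable_bilin borel_measurable_const measurable_x) auto

text \<open>The factor 1/m is the variance of an entry. The leave-one-out bounds hold for all
  samples and supply the common constant \<open>?C\<close> for the function and its
  derivative.\<close>

lemma stein_row:
  assumes i: "i < m" and j: "j < n" and u: "u \<in> carrier_vec d"
  shows "integrable \<Omega> (\<lambda>\<omega>. \<omega> (i, j) * (u \<bullet> (R.Q \<omega> *\<^sub>v x \<omega> i)))"
    and "\<Omega>.expectation (\<lambda>\<omega>. \<omega> (i, j) * (u \<bullet> (R.Q \<omega> *\<^sub>v x \<omega> i))) = \<Omega>.expectation (G u i j) / real m"
proof -
  let ?F = "\<lambda>\<omega>. u \<bullet> (R.Q \<omega> *\<^sub>v x \<omega> i)"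
  let ?C = "max (vec_enorm u * sqrt (1 / lam)) (2 * vec_enorm u * vec_enorm (b j) / lam)"
  have F: "?F \<in> borel_measurable \<Omega>"
    using i u by (intro measurable_bilin measurable_x) auto
  have *: "sqrt (1 / real m) > 0" "finite ({..<m} \<times> {..<n})" "(i, j) \<in> {..<m} \<times> {..<n}"
    using m_pos i j by auto
  have C: "\<bar>?F \<omega>\<bar> \<le> ?C" "\<bar>G u i j \<omega>\<bar> \<le> ?C" for \<omega>
    using abs_Qx_le[OF i u] abs_G_le[OF i j u] by (simp_all add: le_max_iff_disj)
  note stein = stein_PiM_normal[OF *, of ?F "G u i j" ?C, folded gauss_mat_space_def, OF F measurable_G[OF assms] C G_deriv[OF assms]]
  show "integrable \<Omega> (\<lambda>\<omega>. \<omega> (i, j) * ?F \<omega>)" by (rule stein(1))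
  show "\<Omega>.expectation (\<lambda>\<omega>. \<omega> (i, j) * ?F \<omega>) = \<Omega>.expectation (G u i j) / real m"
    using stein(2) by simp
qed

text \<open>\<open>Q_expand\<close> is averaged after x_i . v has been written as a linear form in
  the entries of row i; each entry is then removed by integration by parts.\<close>

lemma expectation_Q_expand:
  assumes u: "u \<in> carrier_vec d" and v: "v \<in> carrier_vec d"
  shows "u \<bullet> v - lam * \<Omega>.expectation (\<lambda>\<omega>. u \<bullet> (R.Q \<omega> *\<^sub>v v))
    = (\<Sum>i<m. \<Sum>j<n. \<Omega>.expectation (G u i j) * (v \<bullet> b j)) / real m"
proof -
  have "u \<bullet> v - lam * (u \<bullet> (R.Q \<omega> *\<^sub>v v))
      = (\<Sum>i<m. \<Sum>j<n. (\<omega> (i, j) * (u \<bullet> (R.Q \<omega> *\<^sub>v x \<omega> i))) * (v \<bullet> b j))" for \<omega>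
    using R.Q_expand[OF u v, of \<omega>] v
    by (simp add: comm_scalar_prod[OF x_carrier v] scalar_prod_x sum_distrib_left sum_distrib_right mult_ac)
  then have "\<Omega>.expectation (\<lambda>\<omega>. u \<bullet> v - lam * (u \<bullet> (R.Q \<omega> *\<^sub>v v)))
      = \<Omega>.expectation (\<lambda>\<omega>. \<Sum>i<m. \<Sum>j<n. (\<omega> (i, j) * (u \<bullet> (R.Q \<omega> *\<^sub>v x \<omega> i))) * (v \<bullet> b j))"
    by simp
  also have "\<dots> = (\<Sum>i<m. \<Sum>j<n. \<Omega>.expectation (G u i j) / real m * (v \<bullet> b j))"
  proof -
    have int: "integrable \<Omega> (\<lambda>\<omega>. \<omega> (i, j) * (u \<bullet> (R.Q \<omega> *\<^sub>v x \<omega> i)))" if "i < m" "j < n" for i j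
      using stein_row(1)[OF that u] .
    show ?thesis
      by (subst integral_double_sum[OF int]) (auto intro!: sum.cong simp: stein_row(2)[OF _ _ u])
  qed
  also have "\<dots> = (\<Sum>i<m. \<Sum>j<n. \<Omega>.expectation (G u i j) * (v \<bullet> b j)) / real m"
    by (simp add: sum_divide_distrib)
  finally show ?thesis
    using integrable_bilin[OF u v] by (simp add: \<Omega>.prob_space)
qed

text \<open>The sum of b_j b_j^T, which is also the expectation of the sum of the x_i x_i^T. Its
  ridge is zero, so it is treated with \<open>reg_mat_scalar_prod\<close> and not as an instance of
  \<open>ridge\<close>.\<close>

abbreviation "W \<equiv> reg_mat d 0 {..<n} b"

lemma W_vec_carrier [simp]: "W *\<^sub>v v \<in> carrier_vec d"
  by (rule carrier_vecI) (simp add: reg_mat_def)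

lemma W_scalar_prod:
  "u \<in> carrier_vec d \<Longrightarrow> v \<in> carrier_vec d \<Longrightarrow> u \<bullet> (W *\<^sub>v v) = (\<Sum>j<n. (u \<bullet> b j) * (v \<bullet> b j))"
  by (subst reg_mat_scalar_prod) (auto intro!: sum.cong b_carrier simp: comm_scalar_prod[OF b_carrier, of _ v])

text \<open>Summation over i eliminates the rows. The factors 1 - x_i . Q x_i add up to m - (d - lam
  tr Q) by \<open>trQ_eq\<close>; the products (u . Q x_i)(b_j . Q x_i) add up to u . Q b_j - lam u
  . Q^2 b_j by \<open>Q_expand\<close> at Q b_j. The latter are the terms of lower order.\<close>

lemma sum_G:
  assumes u: "u \<in> carrier_vec d" and v: "v \<in> carrier_vec d"
  shows "(\<Sum>i<m. \<Sum>j<n. G u i j \<omega> * (v \<bullet> b j))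
    = (u \<bullet> (R.Q \<omega> *\<^sub>v (W *\<^sub>v v))) * (real m - (real d - lam * trQ \<omega>) - 1)
      + lam * (u \<bullet> (R.Q \<omega> *\<^sub>v (R.Q \<omega> *\<^sub>v (W *\<^sub>v v))))"
proof -
  let ?Q = "R.Q \<omega>"
  have G: "(\<Sum>i<m. G u i j \<omega>) = (u \<bullet> (?Q *\<^sub>v b j)) * (real m - (real d - lam * trQ \<omega>) - 1)
      + lam * (u \<bullet> (?Q *\<^sub>v (?Q *\<^sub>v b j)))" if j: "j < n" for j
  proof -
    have "(\<Sum>i<m. G u i j \<omega>) = (u \<bullet> (?Q *\<^sub>v b j)) * (real m - (\<Sum>i<m. x \<omega> i \<bullet> (?Q *\<^sub>v x \<omega> i)))
        - (\<Sum>i<m. (u \<bullet> (?Q *\<^sub>v x \<omega> i)) * (b j \<bullet> (?Q *\<^sub>v x \<omega> i)))"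
      by (simp add: G_def sum_subtractf right_diff_distrib flip: sum_distrib_left)
    also have "(\<Sum>i<m. (u \<bullet> (?Q *\<^sub>v x \<omega> i)) * (b j \<bullet> (?Q *\<^sub>v x \<omega> i)))
        = u \<bullet> (?Q *\<^sub>v b j) - lam * (u \<bullet> (?Q *\<^sub>v (?Q *\<^sub>v b j)))"
      using R.Q_expand[OF u R.Q_vec_carrier[where \<omega> = \<omega> and v = "b j"], where \<omega> = \<omega>]
      by (simp add: R.Q_sym[OF b_carrier[OF j] x_carrier] comm_scalar_prod[OF R.Q_vec_carrier x_carrier])
    finally show ?thesis by (simp add: trQ_eq algebra_simps)
  qed
  have "(\<Sum>i<m. \<Sum>j<n. G u i j \<omega> * (v \<bullet> b j)) = (\<Sum>j<n. (\<Sum>i<m. G u i j \<omega>) * (v \<bullet> b j))"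
    by (subst sum.swap) (simp add: sum_distrib_right)
  also have "\<dots> = (\<Sum>j<n. (u \<bullet> (?Q *\<^sub>v b j)) * (v \<bullet> b j)) * (real m - (real d - lam * trQ \<omega>) - 1)
      + lam * (\<Sum>j<n. (u \<bullet> (?Q *\<^sub>v (?Q *\<^sub>v b j))) * (v \<bullet> b j))"
    unfolding sum_distrib_right sum_distrib_left sum.distrib[symmetric]
    by (intro sum.cong refl) (subst sum_distrib_right[symmetric], subst G, simp, simp add: algebra_simps)
  also have "(\<Sum>j<n. (u \<bullet> (?Q *\<^sub>v b j)) * (v \<bullet> b j)) = u \<bullet> (?Q *\<^sub>v (W *\<^sub>v v))"
    using u v by (simp add: R.Q_sym W_scalar_prod b_carrier)
  also have "(\<Sum>j<n. (u \<bullet> (?Q *\<^sub>v (?Q *\<^sub>v b j))) * (v \<bullet> b j)) = u \<bullet> (?Q *\<^sub>v (?Q *\<^sub>v (W *\<^sub>v v)))"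
    using u v by (simp add: R.Q_sym W_scalar_prod b_carrier)
  finally show ?thesis .
qed

lemma integrable_bilin2:
  assumes u: "u \<in> carrier_vec d" and v: "v \<in> carrier_vec d"
  shows "integrable \<Omega> (\<lambda>\<omega>. u \<bullet> (R.Q \<omega> *\<^sub>v (R.Q \<omega> *\<^sub>v v)))"
    and "\<bar>u \<bullet> (R.Q \<omega> *\<^sub>v (R.Q \<omega> *\<^sub>v v))\<bar> \<le> vec_enorm u * vec_enorm v / lam\<^sup>2"
proof -
  show le: "\<bar>u \<bullet> (R.Q \<omega> *\<^sub>v (R.Q \<omega> *\<^sub>v v))\<bar> \<le> vec_enorm u * vec_enorm v / lam\<^sup>2" for \<omega>
  proof -
    have "\<bar>u \<bullet> (R.Q \<omega> *\<^sub>v (R.Q \<omega> *\<^sub>v v))\<bar> \<le> vec_enorm u * vec_enorm (R.Q \<omega> *\<^sub>v v) / lam"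
      using u by (intro R.Q_bilin_le) auto
    also have "\<dots> \<le> vec_enorm u * (vec_enorm v / lam) / lam"
      using lam_pos R.Q_enorm_le[OF v] by (intro divide_right_mono mult_left_mono) auto
    finally show ?thesis by (simp add: power2_eq_square)
  qed
  show "integrable \<Omega> (\<lambda>\<omega>. u \<bullet> (R.Q \<omega> *\<^sub>v (R.Q \<omega> *\<^sub>v v)))"
    by (rule \<Omega>.integrable_const_bound[of _ "vec_enorm u * vec_enorm v / lam\<^sup>2"])
       (use u v le in \<open>auto intro!: measurable_bilin2\<close>)
qed

section \<open>The approximate equation for the expected resolvent\<close>

definition r :: "real vec \<Rightarrow> real vec \<Rightarrow> real" where
  "r u v = \<Omega>.expectation (\<lambda>\<omega>. u \<bullet> (R.Q \<omega> *\<^sub>v v))"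

text \<open>By \<open>trQ_eq\<close> this is the average over the rows of the expectation of x_i . Q
  x_i.\<close>

definition t :: real where
  "t = (real d - lam * \<Omega>.expectation trQ) / real m"

lemma abs_r_le:
  assumes u: "u \<in> carrier_vec d" and v: "v \<in> carrier_vec d"
  shows "\<bar>r u v\<bar> \<le> vec_enorm u * vec_enorm v / lam"
proof -
  have "\<bar>r u v\<bar> \<le> \<Omega>.expectation (\<lambda>\<omega>. \<bar>u \<bullet> (R.Q \<omega> *\<^sub>v v)\<bar>)"
    unfolding r_def by (rule integral_abs_bound)
  also have "\<dots> \<le> \<Omega>.expectation (\<lambda>_. vec_enorm u * vec_enorm v / lam)"
    using integrable_bilin[OF u v] R.Q_bilin_le[OF u v] by (intro integral_mono) auto
  finally show ?thesis by (simp add: \<Omega>.prob_space)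
qed

text \<open>On average Q (lam I + (1 - t) W) is nearly I. With K = |u| |z| / lam bounding u . Q z,
  replacing the trace in \<open>sum_G\<close> by its mean costs lam K (sqrt m / lam) / m = K / sqrt
  m. The two lower-order terms of \<open>sum_G\<close> are at most K each and give 2 K / m.\<close>

lemma self_consistency:
  assumes u: "u \<in> carrier_vec d" and v: "v \<in> carrier_vec d"
  defines "z \<equiv> W *\<^sub>v v"
  shows "\<bar>u \<bullet> v - lam * r u v - (1 - t) * r u z\<bar>
    \<le> vec_enorm u * vec_enorm z / lam * (1 / sqrt (real m) + 2 / real m)"
proof -
  have z: "z \<in> carrier_vec d" by (simp add: z_def)
  let ?f = "\<lambda>\<omega>. u \<bullet> (R.Q \<omega> *\<^sub>v z)" and ?h = "\<lambda>\<omega>. u \<bullet> (R.Q \<omega> *\<^sub>v (R.Q \<omega> *\<^sub>v z))"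
  let ?T = "\<Omega>.expectation trQ" and ?K = "vec_enorm u * vec_enorm z / lam"
  have K: "0 \<le> ?K" using lam_pos by simp
  have [measurable]: "?f \<in> borel_measurable \<Omega>"
    using u z by (intro measurable_bilin) auto
  note [simp] = integrable_bilin[OF u z] integrable_bilin2(1)[OF u z]
  have int_dev: "integrable \<Omega> (\<lambda>\<omega>. \<bar>trQ \<omega> - ?T\<bar>)" by simp
  have f_le: "\<bar>?f \<omega>\<bar> \<le> ?K" for \<omega> by (rule R.Q_bilin_le[OF u z])
  have le_dev: "\<bar>?f \<omega> * (trQ \<omega> - ?T)\<bar> \<le> ?K * \<bar>trQ \<omega> - ?T\<bar>" for \<omega>
    unfolding abs_mult by (rule mult_right_mono[OF f_le]) simp
  have [simp]: "integrable \<Omega> (\<lambda>\<omega>. ?f \<omega> * (trQ \<omega> - ?T))"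
    by (rule Bochner_Integration.integrable_bound[of _ "\<lambda>\<omega>. ?K * \<bar>trQ \<omega> - ?T\<bar>"])
       (use le_dev K lam_pos in \<open>auto simp: abs_mult\<close>)
  have intG: "integrable \<Omega> (G u i j)" if "i < m" "j < n" for i j
    by (rule \<Omega>.integrable_const_bound[OF _ measurable_G[OF that u]]) (use abs_G_le[OF that u] in auto)
  have "(\<Sum>i<m. \<Sum>j<n. \<Omega>.expectation (G u i j) * (v \<bullet> b j))
      = \<Omega>.expectation (\<lambda>\<omega>. \<Sum>i<m. \<Sum>j<n. G u i j \<omega> * (v \<bullet> b j))"
    by (rule integral_double_sum[OF intG, symmetric])
  also have "\<dots> = \<Omega>.expectation (\<lambda>\<omega>. (1 - t) * real m * ?f \<omega> + lam * (?f \<omega> * (trQ \<omega> - ?T)) + lam * ?h \<omega> - ?f \<omega>)"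
  proof (rule Bochner_Integration.integral_cong[OF refl])
    \<comment> \<open>This form of d separates the mean of the trace, absorbed in t, from its
      deviation.\<close>
    have d: "real d = real m * t + lam * ?T" using m_pos by (simp add: t_def)
    show "(\<Sum>i<m. \<Sum>j<n. G u i j \<omega> * (v \<bullet> b j))
      = (1 - t) * real m * ?f \<omega> + lam * (?f \<omega> * (trQ \<omega> - ?T)) + lam * ?h \<omega> - ?f \<omega>" for \<omega>
      unfolding sum_G[OF u v] z_def[symmetric] d by (simp add: algebra_simps)
  qed
  also have "\<dots> = (1 - t) * real m * r u z + lam * \<Omega>.expectation (\<lambda>\<omega>. ?f \<omega> * (trQ \<omega> - ?T))
      + \<Omega>.expectation (\<lambda>\<omega>. lam * ?h \<omega> - ?f \<omega>)"
    by (simp add: r_def)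
  finally have "u \<bullet> v - lam * r u v - (1 - t) * r u z
      = (lam * \<Omega>.expectation (\<lambda>\<omega>. ?f \<omega> * (trQ \<omega> - ?T)) + \<Omega>.expectation (\<lambda>\<omega>. lam * ?h \<omega> - ?f \<omega>)) / real m"
    using expectation_Q_expand[OF u v] m_pos unfolding r_def by (simp add: field_simps)
  moreover have "\<bar>\<Omega>.expectation (\<lambda>\<omega>. ?f \<omega> * (trQ \<omega> - ?T))\<bar> \<le> ?K * (sqrt (real m) / lam)"
  proof -
    have "\<bar>\<Omega>.expectation (\<lambda>\<omega>. ?f \<omega> * (trQ \<omega> - ?T))\<bar> \<le> \<Omega>.expectation (\<lambda>\<omega>. \<bar>?f \<omega> * (trQ \<omega> - ?T)\<bar>)"
      by (rule integral_abs_bound)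
    also have "\<dots> \<le> \<Omega>.expectation (\<lambda>\<omega>. ?K * \<bar>trQ \<omega> - ?T\<bar>)"
      using le_dev int_dev by (intro integral_mono) auto
    also have "\<dots> \<le> ?K * (sqrt (real m) / lam)"
      using mult_left_mono[OF trQ_mean_deviation K] by simp
    finally show ?thesis .
  qed
  moreover have "\<bar>\<Omega>.expectation (\<lambda>\<omega>. lam * ?h \<omega> - ?f \<omega>)\<bar> \<le> 2 * ?K"
  proof -
    have "\<bar>\<Omega>.expectation (\<lambda>\<omega>. lam * ?h \<omega> - ?f \<omega>)\<bar> \<le> \<Omega>.expectation (\<lambda>\<omega>. \<bar>lam * ?h \<omega> - ?f \<omega>\<bar>)"
      by (rule integral_abs_bound)
    also have "\<dots> \<le> \<Omega>.expectation (\<lambda>_. 2 * ?K)"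
    proof (rule integral_mono)
      fix \<omega>
      have "\<bar>lam * ?h \<omega>\<bar> = lam * \<bar>?h \<omega>\<bar>"
        using lam_pos by (simp add: abs_mult)
      also have "\<dots> \<le> lam * (vec_enorm u * vec_enorm z / lam\<^sup>2)"
        using lam_pos by (intro mult_left_mono integrable_bilin2(2)[OF u z]) simp
      also have "\<dots> = ?K" using lam_pos by (simp add: power2_eq_square)
      finally show "\<bar>lam * ?h \<omega> - ?f \<omega>\<bar> \<le> 2 * ?K" using f_le[of \<omega>] by linarith
    qed auto
    finally show ?thesis by (simp add: \<Omega>.prob_space)
  qed
  moreover have "\<bar>lam * E1 + E2\<bar> / real m \<le> (lam * B + 2 * ?K) / real m"
    if "\<bar>E1\<bar> \<le> B" "\<bar>E2\<bar> \<le> 2 * ?K" for E1 E2 B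
  proof -
    have "\<bar>lam * E1\<bar> \<le> lam * B"
      using mult_left_mono[OF that(1), of lam] lam_pos by (simp add: abs_mult)
    then show ?thesis
      using that(2) by (intro divide_right_mono) linarith+
  qed
  ultimately have "\<bar>u \<bullet> v - lam * r u v - (1 - t) * r u z\<bar>
     \<le> (lam * (?K * (sqrt (real m) / lam)) + 2 * ?K) / real m"
    by (simp only: abs_divide abs_of_nat)
  also have "lam * (?K * (sqrt (real m) / lam)) = ?K * sqrt (real m)"
    using lam_pos by simp
  also have "(?K * sqrt (real m) + 2 * ?K) / real m = ?K * (sqrt (real m) / real m + 2 / real m)"
    by (simp add: distrib_left add_divide_distrib)
  also have "sqrt (real m) / real m = 1 / sqrt (real m)"
    using m_pos by (simp add: field_simps)
  finally show ?thesis .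
qed

end

section \<open>Comparison with the deterministic resolvent\<close>

text \<open>The trace of a product of two positive semidefinite maps, without square roots: Q = Q M
  Q = lam Q^2 + sum of Q x_i x_i^T Q, so cyclicity turns tr(Q K) into lam times the sum of K-forms
  at the Q e_b plus the sum of K-forms at the Q x_i.\<close>

lemma (in ridge) trace_mult_nonneg:
  assumes K: "\<And>v. v \<in> carrier_vec d \<Longrightarrow> K v \<in> carrier_vec d"
    and sym: "\<And>u v. u \<in> carrier_vec d \<Longrightarrow> v \<in> carrier_vec d \<Longrightarrow> u \<bullet> K v = K u \<bullet> v"
    and psd: "\<And>v. v \<in> carrier_vec d \<Longrightarrow> 0 \<le> v \<bullet> K v"
  shows "0 \<le> (\<Sum>a<d. unit_vec d a \<bullet> (Q *\<^sub>v K (unit_vec d a)))"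
proof -
  let ?e = "unit_vec d"
  have QK: "u \<bullet> (Q *\<^sub>v K v) = K (Q *\<^sub>v u) \<bullet> v" if "u \<in> carrier_vec d" "v \<in> carrier_vec d" for u v
    using that by (simp add: Q_sym K sym)
  have cyc: "(\<Sum>a<d. (?e a \<bullet> (Q *\<^sub>v u)) * (u \<bullet> (Q *\<^sub>v K (?e a)))) = (Q *\<^sub>v u) \<bullet> K (Q *\<^sub>v u)"
    if u: "u \<in> carrier_vec d" for u
    using u by (simp only: QK unit_vec_carrier unit_vec_sum_scalar_prod[OF Q_vec_carrier K[OF Q_vec_carrier]])
  have "(\<Sum>a<d. ?e a \<bullet> (Q *\<^sub>v K (?e a)))
      = lam * (\<Sum>a<d. ?e a \<bullet> (Q *\<^sub>v (Q *\<^sub>v K (?e a)))) + (\<Sum>a<d. \<Sum>i\<in>I. (?e a \<bullet> (Q *\<^sub>v x i)) * (x i \<bullet> (Q *\<^sub>v K (?e a))))"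
    unfolding sum_distrib_left sum.distrib[symmetric] by (intro sum.cong refl Q_expand) auto
  also have "(\<Sum>a<d. ?e a \<bullet> (Q *\<^sub>v (Q *\<^sub>v K (?e a))))
      = (\<Sum>a<d. \<Sum>b<d. (?e a \<bullet> (Q *\<^sub>v ?e b)) * (?e b \<bullet> (Q *\<^sub>v K (?e a))))"
  proof (intro sum.cong refl)
    fix a
    show "?e a \<bullet> (Q *\<^sub>v (Q *\<^sub>v K (?e a))) = (\<Sum>b<d. (?e a \<bullet> (Q *\<^sub>v ?e b)) * (?e b \<bullet> (Q *\<^sub>v K (?e a))))"
      using unit_vec_sum_scalar_prod[of "Q *\<^sub>v K (?e a)" d "Q *\<^sub>v ?e a"]
        comm_scalar_prod[of "Q *\<^sub>v K (?e a)" d "Q *\<^sub>v ?e a"]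
      by (simp add: Q_sym[of "?e a"] mult.commute)
  qed
  also have "\<dots> = (\<Sum>b<d. (Q *\<^sub>v ?e b) \<bullet> K (Q *\<^sub>v ?e b))"
    by (subst sum.swap) (simp only: cyc unit_vec_carrier)
  also have "(\<Sum>a<d. \<Sum>i\<in>I. (?e a \<bullet> (Q *\<^sub>v x i)) * (x i \<bullet> (Q *\<^sub>v K (?e a)))) = (\<Sum>i\<in>I. (Q *\<^sub>v x i) \<bullet> K (Q *\<^sub>v x i))"
    by (subst sum.swap, intro sum.cong refl) (simp only: cyc x_carrier)
  finally show ?thesis
    using lam_pos by (simp add: psd sum_nonneg)
qed

lemma vec_eq_by_scalar_prod:
  assumes "u \<in> carrier_vec d" "v \<in> carrier_vec d" "\<And>w. w \<in> carrier_vec d \<Longrightarrow> w \<bullet> u = w \<bullet> (v :: real vec)"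
  shows "u = v"
proof (rule eq_vecI)
  show "u $ a = v $ a" if "a < dim_vec v" for a
    using that assms(1,2) assms(3)[of "unit_vec d a"] by simp
qed (use assms in auto)

text \<open>Testing the form at u = B v gives |B v|^2 \<le> C |B v| |v|. The lower bound relies on C
  as well, since \<open>Sup\<close> on the reals needs a set bounded above; the zero vector makes
  the set nonempty.\<close>

lemma spec_norm_bounds:
  assumes B: "B \<in> carrier_mat d d"
    and le: "\<And>u v. u \<in> carrier_vec d \<Longrightarrow> v \<in> carrier_vec d \<Longrightarrow> \<bar>u \<bullet> (B *\<^sub>v v)\<bar> \<le> C * (vec_enorm u * vec_enorm v)"
    and C: "0 \<le> C"
  shows "0 \<le> spec_norm B" "spec_norm B \<le> C"
proof -
  let ?S = "{vec_enorm (B *\<^sub>v v) | v. v \<in> carrier_vec (dim_col B) \<and> vec_enorm v \<le> 1}"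
  have le_C: "vec_enorm (B *\<^sub>v v) \<le> C" if v: "v \<in> carrier_vec d" "vec_enorm v \<le> 1" for v
  proof (cases "vec_enorm (B *\<^sub>v v) = 0")
    case False
    have "(vec_enorm (B *\<^sub>v v))\<^sup>2 \<le> C * (vec_enorm (B *\<^sub>v v) * vec_enorm v)"
      using le[OF mult_mat_vec_carrier[OF B v(1)] v(1)] by (simp add: vec_enorm_sq)
    also have "\<dots> \<le> C * (vec_enorm (B *\<^sub>v v) * 1)"
      using C v(2) by (intro mult_left_mono) auto
    finally show ?thesis
      using False vec_enorm_nonneg[of "B *\<^sub>v v"] by (simp add: power2_eq_square less_le)
  qed (use C in simp)
  have upper: "s \<le> C" if "s \<in> ?S" for s
    using that B le_C by auto
  have "vec_enorm (0\<^sub>v d) = 0" by (simp add: vec_enorm_def)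
  moreover have "B *\<^sub>v 0\<^sub>v d = 0\<^sub>v d" using B by auto
  ultimately have zero: "0 \<in> ?S" using B by (auto intro!: exI[of _ "0\<^sub>v d"])
  show "0 \<le> spec_norm B"
    unfolding spec_norm_def using zero upper by (intro cSup_upper bdd_aboveI) auto
  show "spec_norm B \<le> C"
    unfolding spec_norm_def using zero upper by (intro cSup_least) auto
qed

text \<open>The c_j stand for the rows of A / sqrt n. Putting sqrt \<gamma> into the random rows
  only makes \<open>R.Q\<close> the corrected sketched resolvent, while \<open>C.Q\<close>, built
  from the c_j themselves, is the inverse of H.\<close>

locale sketch =
  fixes m n d :: nat and lam \<gamma> :: real and c :: "nat \<Rightarrow> real vec"
  assumes m_pos: "m > 0" and lam_pos: "lam > 0" and c_carrier: "\<And>j. j < n \<Longrightarrow> c j \<in> carrier_vec d"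
    and \<gamma>_pos: "\<gamma> > 0"
begin

sublocale gauss_model m n d lam "\<lambda>j. sqrt \<gamma> \<cdot>\<^sub>v c j"
  by unfold_locales (auto simp: m_pos lam_pos c_carrier)

sublocale C: ridge d lam "{..<n}" c
  by unfold_locales (auto simp: lam_pos c_carrier)

abbreviation "P \<equiv> C.Q"

definition "trP = (\<Sum>a<d. unit_vec d a \<bullet> (P *\<^sub>v unit_vec d a))"

text \<open>The map \<Sigma> P, written without \<Sigma> since P inverts \<Sigma> + lam I. In this
  form its symmetry, positivity and norm bound follow from those of P.\<close>

definition K :: "real vec \<Rightarrow> real vec" where
  "K z = z - lam \<cdot>\<^sub>v (P *\<^sub>v z)"

lemma K_carrier [simp]: "z \<in> carrier_vec d \<Longrightarrow> K z \<in> carrier_vec d"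
  by (simp add: K_def)

lemma scalar_prod_K:
  "u \<in> carrier_vec d \<Longrightarrow> z \<in> carrier_vec d \<Longrightarrow> u \<bullet> K z = u \<bullet> z - lam * (u \<bullet> (P *\<^sub>v z))"
  by (simp add: K_def scalar_prod_minus_distrib[where n = d] scalar_prod_smult_distrib[where n = d])

lemma K_sym: "u \<in> carrier_vec d \<Longrightarrow> z \<in> carrier_vec d \<Longrightarrow> u \<bullet> K z = K u \<bullet> z"
  using comm_scalar_prod[of "K u" d z] comm_scalar_prod[of z d u] comm_scalar_prod[of z d "P *\<^sub>v u"]
  by (simp add: scalar_prod_K C.Q_sym)

lemma K_psd: "z \<in> carrier_vec d \<Longrightarrow> 0 \<le> z \<bullet> K z"
  using abs_le_D1[OF C.Q_bilin_le, of z z] lam_pos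
  by (simp add: scalar_prod_K field_simps power2_eq_square flip: vec_enorm_sq)

text \<open>The constant is 1 + 1, from |z| and |lam P z| \<le> |z|, with the form tested at K
  z.\<close>

lemma enorm_K_le:
  assumes z: "z \<in> carrier_vec d"
  shows "vec_enorm (K z) \<le> 2 * vec_enorm z"
proof (cases "vec_enorm (K z) = 0")
  case False
  have "(vec_enorm (K z))\<^sup>2 = K z \<bullet> z - lam * (K z \<bullet> (P *\<^sub>v z))"
    using z by (simp add: vec_enorm_sq scalar_prod_K)
  also have "\<dots> \<le> vec_enorm (K z) * (2 * vec_enorm z)"
  proof -
    have "lam * \<bar>K z \<bullet> (P *\<^sub>v z)\<bar> \<le> vec_enorm (K z) * vec_enorm z"
      using C.Q_bilin_le[of "K z" z] z lam_pos by (simp add: field_simps)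
    then have "\<bar>lam * (K z \<bullet> (P *\<^sub>v z))\<bar> \<le> vec_enorm (K z) * vec_enorm z"
      using lam_pos by (simp add: abs_mult)
    then show ?thesis
      using scalar_prod_vec_enorm_le[of "K z" d z] z by (simp add: algebra_simps abs_le_iff)
  qed
  finally show ?thesis
    using False vec_enorm_nonneg[of "K z"] by (simp add: power2_eq_square less_le)
qed simp

text \<open>Here W = \<gamma> \<Sigma>, so this is \<Sigma> P = I - lam P scaled by
  \<gamma>.\<close>

lemma W_P:
  assumes z: "z \<in> carrier_vec d"
  shows "W *\<^sub>v (P *\<^sub>v z) = \<gamma> \<cdot>\<^sub>v K z"
proof (rule vec_eq_by_scalar_prod[of _ d])
  fix u :: "real vec" assume u: "u \<in> carrier_vec d"
  have "u \<bullet> (W *\<^sub>v (P *\<^sub>v z)) = (\<Sum>j<n. \<gamma> * ((u \<bullet> c j) * ((P *\<^sub>v z) \<bullet> c j)))"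
    unfolding W_scalar_prod[OF u C.Q_vec_carrier]
  proof (intro sum.cong refl)
    fix j assume "j \<in> {..<n}"
    then have [simp]: "c j \<in> carrier_vec d" by (simp add: c_carrier)
    have "sqrt \<gamma> * sqrt \<gamma> = \<gamma>" using \<gamma>_pos by simp
    then show "u \<bullet> (sqrt \<gamma> \<cdot>\<^sub>v c j) * ((P *\<^sub>v z) \<bullet> (sqrt \<gamma> \<cdot>\<^sub>v c j)) = \<gamma> * ((u \<bullet> c j) * ((P *\<^sub>v z) \<bullet> c j))"
      using u by (simp add: scalar_prod_smult_distrib[where n = d] mult_ac)
  qed
  also have "\<dots> = \<gamma> * (u \<bullet> (C.M *\<^sub>v (P *\<^sub>v z)) - lam * (u \<bullet> (P *\<^sub>v z)))"
    using u by (simp add: C.M_scalar_prod sum_distrib_left comm_scalar_prod[OF C.Q_vec_carrier c_carrier])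
  also have "\<dots> = u \<bullet> (\<gamma> \<cdot>\<^sub>v K z)"
    using u z by (simp add: C.M_Q_vec scalar_prod_K scalar_prod_smult_distrib[where n = d])
  finally show "u \<bullet> (W *\<^sub>v (P *\<^sub>v z)) = u \<bullet> (\<gamma> \<cdot>\<^sub>v K z)" .
qed (use z in auto)

lemma r_smult: "u \<in> carrier_vec d \<Longrightarrow> v \<in> carrier_vec d \<Longrightarrow> r u (a \<cdot>\<^sub>v v) = a * r u v"
  by (simp add: r_def R.Q_sym scalar_prod_smult_distrib[where n = d])

lemma r_K:
  assumes u: "u \<in> carrier_vec d" and z: "z \<in> carrier_vec d"
  shows "r u (K z) = r u z - lam * r u (P *\<^sub>v z)"
proof -
  have "u \<bullet> (R.Q \<omega> *\<^sub>v K z) = u \<bullet> (R.Q \<omega> *\<^sub>v z) - lam * (u \<bullet> (R.Q \<omega> *\<^sub>v (P *\<^sub>v z)))" for \<omega>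
    using u z by (simp add: R.Q_sym scalar_prod_K)
  then show ?thesis
    using integrable_bilin[OF u z] integrable_bilin[OF u C.Q_vec_carrier] by (simp add: r_def)
qed

text \<open>The error factor of \<open>self_consistency\<close> once |W P z| \<le> 2 \<gamma> |z| is
  inserted.\<close>

definition \<delta> :: real where "\<delta> = 2 * \<gamma> / lam * (1 / sqrt (real m) + 2 / real m)"

lemma \<delta>_nonneg: "0 \<le> \<delta>"
  using \<gamma>_pos lam_pos by (simp add: \<delta>_def)

text \<open>\<open>self_consistency\<close> is taken at v = P z. There lam r(u, P z) = r(u, z) -
  r(u, K z) and W P z = \<gamma> K z, so the terms in K z combine with the coefficient 1 - \<gamma>
  (1 - t).\<close>

lemma r_minus_P:
  assumes u: "u \<in> carrier_vec d" and z: "z \<in> carrier_vec d"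
  shows "\<bar>r u z - u \<bullet> (P *\<^sub>v z) - (1 - \<gamma> * (1 - t)) * r u (K z)\<bar> \<le> \<delta> * (vec_enorm u * vec_enorm z)"
proof -
  have "r u z - u \<bullet> (P *\<^sub>v z) - (1 - \<gamma> * (1 - t)) * r u (K z)
      = - (u \<bullet> (P *\<^sub>v z) - lam * r u (P *\<^sub>v z) - (1 - t) * r u (W *\<^sub>v (P *\<^sub>v z)))"
    using u z by (simp add: W_P r_smult) (simp add: r_K algebra_simps)
  then have "\<bar>r u z - u \<bullet> (P *\<^sub>v z) - (1 - \<gamma> * (1 - t)) * r u (K z)\<bar>
      = \<bar>u \<bullet> (P *\<^sub>v z) - lam * r u (P *\<^sub>v z) - (1 - t) * r u (W *\<^sub>v (P *\<^sub>v z))\<bar>"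
    by (simp only: abs_minus_cancel)
  also have "\<dots> \<le> vec_enorm u * vec_enorm (W *\<^sub>v (P *\<^sub>v z)) / lam * (1 / sqrt (real m) + 2 / real m)"
    by (rule self_consistency[OF u C.Q_vec_carrier])
  also have "\<dots> \<le> vec_enorm u * (\<gamma> * (2 * vec_enorm z)) / lam * (1 / sqrt (real m) + 2 / real m)"
    using enorm_K_le[OF z] \<gamma>_pos lam_pos
    by (intro mult_right_mono divide_right_mono mult_left_mono) (auto simp: W_P[OF z] vec_enorm_smult)
  also have "\<dots> = \<delta> * (vec_enorm u * vec_enorm z)"
    by (simp add: \<delta>_def)
  finally show ?thesis .
qed

lemma trace_r: "(\<Sum>a<d. r (unit_vec d a) (unit_vec d a)) = \<Omega>.expectation trQ"
  unfolding r_def trQ_def[abs_def]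
  by (intro Bochner_Integration.integral_sum[symmetric] integrable_bilin; simp)

lemma trace_r_K_nonneg: "0 \<le> (\<Sum>a<d. r (unit_vec d a) (K (unit_vec d a)))"
proof -
  have "(\<Sum>a<d. r (unit_vec d a) (K (unit_vec d a)))
      = \<Omega>.expectation (\<lambda>\<omega>. \<Sum>a<d. unit_vec d a \<bullet> (R.Q \<omega> *\<^sub>v K (unit_vec d a)))"
    unfolding r_def by (intro Bochner_Integration.integral_sum[symmetric] integrable_bilin; simp)
  also have "0 \<le> \<dots>"
    by (intro integral_nonneg_AE AE_I2 R.trace_mult_nonneg K_carrier K_sym K_psd)
  finally show ?thesis .
qed

text \<open>Put p = E tr Q - tr P, q = \<gamma> lam / m and let X \<ge> 0 be the trace of
  \<open>trace_r_K_nonneg\<close>. Since 1 - \<gamma> (1 - t) = - q p, summing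
  \<open>r_minus_P\<close> over the basis gives |p (1 + q X)| \<le> d \<delta>, hence |p| \<le> d
  \<delta>. This alone need not be small, but only q p matters, which turns d into d/m.\<close>

lemma \<gamma>_t_bound:
  assumes \<gamma>: "\<gamma> * (1 - (real d - lam * trP) / real m) = 1"
  shows "\<bar>1 - \<gamma> * (1 - t)\<bar> \<le> \<gamma> * lam * \<delta> * (real d / real m)"
proof -
  let ?T = "\<Omega>.expectation trQ" and ?e = "unit_vec d"
  let ?X = "\<Sum>a<d. r (?e a) (K (?e a))"
  have t: "1 - \<gamma> * (1 - t) = - (\<gamma> * lam / real m) * (?T - trP)"
    using \<gamma> by (simp add: t_def diff_divide_distrib algebra_simps)
  have "\<bar>?T - trP - (1 - \<gamma> * (1 - t)) * ?X\<bar>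
      = \<bar>\<Sum>a<d. r (?e a) (?e a) - ?e a \<bullet> (P *\<^sub>v ?e a) - (1 - \<gamma> * (1 - t)) * r (?e a) (K (?e a))\<bar>"
    by (simp add: sum_subtractf trP_def trace_r sum_distrib_left)
  also have "\<dots> \<le> (\<Sum>a<d. \<delta> * (vec_enorm (?e a) * vec_enorm (?e a)))"
    by (rule order_trans[OF sum_abs sum_mono]) (rule r_minus_P, auto)
  also have "\<dots> = real d * \<delta>" by simp
  finally have "\<bar>?T - trP - (1 - \<gamma> * (1 - t)) * ?X\<bar> \<le> real d * \<delta>" .
  moreover have "?T - trP - (1 - \<gamma> * (1 - t)) * ?X = (?T - trP) * (1 + \<gamma> * lam / real m * ?X)"
  proof -
    have "p - (- q * p) * s = p * (1 + q * s)" for p q s :: real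
      by (simp add: algebra_simps)
    then show ?thesis unfolding t .
  qed
  ultimately have *: "\<bar>(?T - trP) * (1 + \<gamma> * lam / real m * ?X)\<bar> \<le> real d * \<delta>"
    by (simp only:)
  have "0 \<le> \<gamma> * lam / real m * ?X"
    using trace_r_K_nonneg \<gamma>_pos lam_pos by simp
  then have "\<bar>?T - trP\<bar> * 1 \<le> \<bar>?T - trP\<bar> * \<bar>1 + \<gamma> * lam / real m * ?X\<bar>"
    by (intro mult_left_mono) auto
  also have "\<dots> \<le> real d * \<delta>" using * by (simp only: abs_mult)
  finally have "\<gamma> * lam / real m * \<bar>?T - trP\<bar> \<le> \<gamma> * lam / real m * (real d * \<delta>)"
    using \<gamma>_pos lam_pos by (intro mult_left_mono) auto
  then show ?thesis
    unfolding t using \<gamma>_pos lam_pos by (simp add: abs_mult mult_ac)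
qed

text \<open>The deviation of \<gamma> (1 - t) from 1 multiplies r(u, K z), which is at most 2 |u|
  |z| / lam; the lam cancels and 2 \<gamma> d/m remains.\<close>

lemma expectation_Q_near_P:
  assumes \<gamma>: "\<gamma> * (1 - (real d - lam * trP) / real m) = 1"
    and u: "u \<in> carrier_vec d" and z: "z \<in> carrier_vec d"
  shows "\<bar>r u z - u \<bullet> (P *\<^sub>v z)\<bar> \<le> \<delta> * (1 + 2 * \<gamma> * (real d / real m)) * (vec_enorm u * vec_enorm z)"
proof -
  have "\<bar>r u (K z)\<bar> \<le> vec_enorm u * vec_enorm (K z) / lam"
    using u z by (intro abs_r_le) auto
  also have "\<dots> \<le> vec_enorm u * (2 * vec_enorm z) / lam"
    using enorm_K_le[OF z] lam_pos by (intro divide_right_mono mult_left_mono) auto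
  finally have "\<bar>(1 - \<gamma> * (1 - t)) * r u (K z)\<bar> \<le> (\<gamma> * lam * \<delta> * (real d / real m)) * (vec_enorm u * (2 * vec_enorm z) / lam)"
    unfolding abs_mult by (intro mult_mono \<gamma>_t_bound \<gamma>) (use \<gamma>_pos lam_pos \<delta>_nonneg in auto)
  also have "\<dots> = \<delta> * (2 * \<gamma> * (real d / real m)) * (vec_enorm u * vec_enorm z)"
    using lam_pos by simp
  finally show ?thesis
    using r_minus_P[OF u z] by (simp add: algebra_simps)
qed

lemma scalar_prod_mat_expect:
  assumes u: "u \<in> carrier_vec d" and z: "z \<in> carrier_vec d"
  shows "u \<bullet> (mat_expect \<Omega> d d R.Q *\<^sub>v z) = r u z"
proof -
  have Q: "R.Q \<omega> $$ (a, b) = unit_vec d a \<bullet> (R.Q \<omega> *\<^sub>v unit_vec d b)" if "a < d" "b < d" for a b \<omega>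
    using unit_vec_scalar_prod_mat[OF R.Q_carrier that] by simp
  have int: "integrable \<Omega> (\<lambda>\<omega>. R.Q \<omega> $$ (a, b))" if "a < d" "b < d" for a b
    unfolding Q[OF that] using that by (intro integrable_bilin) auto
  have E: "mat_expect \<Omega> d d R.Q \<in> carrier_mat d d" by (simp add: mat_expect_def)
  have "r u z = \<Omega>.expectation (\<lambda>\<omega>. \<Sum>a<d. \<Sum>b<d. u $ a * R.Q \<omega> $$ (a, b) * z $ b)"
    unfolding r_def by (simp add: scalar_prod_mult_mat_vec[OF u R.Q_carrier z])
  also have "\<dots> = (\<Sum>a<d. \<Sum>b<d. u $ a * \<Omega>.expectation (\<lambda>\<omega>. R.Q \<omega> $$ (a, b)) * z $ b)"
  proof -
    have int': "integrable \<Omega> (\<lambda>\<omega>. u $ a * R.Q \<omega> $$ (a, b) * z $ b)" if "a < d" "b < d" for a b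
      using int[OF that] by (intro integrable_mult_left integrable_mult_right)
    have "\<Omega>.expectation (\<lambda>\<omega>. \<Sum>a<d. \<Sum>b<d. u $ a * R.Q \<omega> $$ (a, b) * z $ b)
        = (\<Sum>a<d. \<Omega>.expectation (\<lambda>\<omega>. \<Sum>b<d. u $ a * R.Q \<omega> $$ (a, b) * z $ b))"
      by (rule Bochner_Integration.integral_sum) (intro Bochner_Integration.integrable_sum int'; simp)
    also have "\<dots> = (\<Sum>a<d. \<Sum>b<d. \<Omega>.expectation (\<lambda>\<omega>. u $ a * R.Q \<omega> $$ (a, b) * z $ b))"
      by (intro sum.cong refl Bochner_Integration.integral_sum int'; simp)
    finally show ?thesis by simp
  qed
  finally show ?thesis
    by (simp add: scalar_prod_mult_mat_vec[OF u E z]) (simp add: mat_expect_def)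
qed

lemma spec_norm_expectation_Q:
  assumes \<gamma>: "\<gamma> * (1 - (real d - lam * trP) / real m) = 1"
  shows "0 \<le> spec_norm (mat_expect \<Omega> d d R.Q - P)"
    and "spec_norm (mat_expect \<Omega> d d R.Q - P) \<le> \<delta> * (1 + 2 * \<gamma> * (real d / real m))"
proof -
  let ?B = "mat_expect \<Omega> d d R.Q - P"
  have E: "mat_expect \<Omega> d d R.Q \<in> carrier_mat d d" by (simp add: mat_expect_def)
  have B: "?B \<in> carrier_mat d d" by (simp add: minus_carrier_mat[OF C.Q_carrier])
  have le: "\<bar>u \<bullet> (?B *\<^sub>v z)\<bar> \<le> \<delta> * (1 + 2 * \<gamma> * (real d / real m)) * (vec_enorm u * vec_enorm z)"
    if u: "u \<in> carrier_vec d" and z: "z \<in> carrier_vec d" for u z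
  proof -
    have "u \<bullet> (?B *\<^sub>v z) = u \<bullet> (mat_expect \<Omega> d d R.Q *\<^sub>v z) - u \<bullet> (P *\<^sub>v z)"
      using minus_mult_distrib_mat_vec[OF E C.Q_carrier z] mult_mat_vec_carrier[OF E z] u
      by (simp add: scalar_prod_minus_distrib[where n = d])
    then show ?thesis
      using expectation_Q_near_P[OF \<gamma> u z] scalar_prod_mat_expect[OF u z] by simp
  qed
  have "0 \<le> \<delta> * (1 + 2 * \<gamma> * (real d / real m))"
    using \<delta>_nonneg \<gamma>_pos by simp
  then show "0 \<le> spec_norm ?B" "spec_norm ?B \<le> \<delta> * (1 + 2 * \<gamma> * (real d / real m))"
    using spec_norm_bounds[OF B le] by blast+
qed

lemma trP_nonneg: "0 \<le> trP"
  unfolding trP_def by (intro sum_nonneg C.Q_quad_nonneg) simp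

end

section \<open>From the matrices of the statement to sums of rank-one matrices\<close>

lemma transpose_mult_self_index:
  assumes "X \<in> carrier_mat n d" "a < d" "b < d"
  shows "(transpose_mat X * X) $$ (a, b) = (\<Sum>i<n. X $$ (i, a) * (X $$ (i, b) :: real))"
  using assms by (simp add: scalar_prod_def atLeast0LessThan)

definition scaled_row :: "nat \<Rightarrow> nat \<Rightarrow> real mat \<Rightarrow> nat \<Rightarrow> real vec" where
  "scaled_row n d A j = vec d (\<lambda>a. A $$ (j, a) / sqrt (real n))"

lemma H_mat_eq_reg_mat:
  assumes "A \<in> carrier_mat n d"
  shows "H_mat n d A lam = reg_mat d lam {..<n} (scaled_row n d A)"
proof (rule eq_matI)
  fix a b assume "a < dim_row (reg_mat d lam {..<n} (scaled_row n d A))" "b < dim_col (reg_mat d lam {..<n} (scaled_row n d A))"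
  then have ab: "a < d" "b < d" by (simp_all add: reg_mat_def)
  then show "H_mat n d A lam $$ (a, b) = reg_mat d lam {..<n} (scaled_row n d A) $$ (a, b)"
    using assms transpose_mult_self_index[OF assms ab]
    by (simp add: H_mat_def gram_def reg_mat_def scaled_row_def sum_divide_distrib del: index_mult_mat(1))
qed (use assms in \<open>auto simp: H_mat_def gram_def reg_mat_def\<close>)

text \<open>A^T S^T S A is the Gram matrix of S A, so the sum runs over the m rows of S A.
  Subtracting lam I before scaling keeps the ridge at lam, and \<gamma> enters the vectors through
  its square root.\<close>

lemma HS_mat_eq_reg_mat:
  assumes A: "A \<in> carrier_mat n d" and \<gamma>: "0 \<le> \<gamma>"
  shows "\<gamma> \<cdot>\<^sub>m (HS_mat n d A (mat_of_sample m n \<omega>) lam - lam \<cdot>\<^sub>m 1\<^sub>m d) + lam \<cdot>\<^sub>m 1\<^sub>m d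
    = reg_mat d lam {..<m} (sample_row n d (\<lambda>j. sqrt \<gamma> \<cdot>\<^sub>v scaled_row n d A j) \<omega>)" (is "?L = ?R")
proof -
  let ?S = "mat_of_sample m n \<omega>"
  let ?x = "sample_row n d (\<lambda>j. sqrt \<gamma> \<cdot>\<^sub>v scaled_row n d A j) \<omega>"
  have S: "?S \<in> carrier_mat m n" by (simp add: mat_of_sample_def)
  have SA: "?S * A \<in> carrier_mat m d" using S A by simp
  have eq: "transpose_mat A * transpose_mat ?S * ?S * A = transpose_mat (?S * A) * (?S * A)"
    using A S assoc_mult_mat[of "transpose_mat A * transpose_mat ?S" d m ?S n A d] transpose_mult[OF S A] by simp
  have x: "?x i $ a = sqrt \<gamma> / sqrt (real n) * (?S * A) $$ (i, a)" if "i < m" "a < d" for i a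
    using that A S by (simp add: sample_row_def scaled_row_def mat_of_sample_def scalar_prod_def
        atLeast0LessThan sum_distrib_left mult_ac)
  show ?thesis
  proof (rule eq_matI)
    fix a b assume "a < dim_row ?R" "b < dim_col ?R"
    then have ab: "a < d" "b < d" by (simp_all add: reg_mat_def)
    have "?L $$ (a, b) = \<gamma> * ((1 / real n) * (\<Sum>i<m. (?S * A) $$ (i, a) * (?S * A) $$ (i, b))) + (if a = b then lam else 0)"
      using ab SA A unfolding HS_mat_def eq transpose_mult_self_index[OF SA ab, symmetric]
      by (simp del: index_mult_mat(1))
    also have "\<dots> = (if a = b then lam else 0) + (\<Sum>i<m. ?x i $ a * ?x i $ b)"
    proof -
      have "?x i $ a * ?x i $ b = \<gamma> * ((1 / real n) * ((?S * A) $$ (i, a) * (?S * A) $$ (i, b)))" if "i < m" for i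
      proof -
        have "sqrt \<gamma> * sqrt \<gamma> = \<gamma>" "sqrt (real n) * sqrt (real n) = real n" using \<gamma> by auto
        then have "(sqrt \<gamma> / sqrt (real n) * p) * (sqrt \<gamma> / sqrt (real n) * q) = \<gamma> * ((1 / real n) * (p * q))" for p q
          by (metis (no_types, opaque_lifting) mult.assoc mult.left_commute mult_1 times_divide_times_eq times_divide_eq_left)
        then show ?thesis unfolding x[OF that ab(1)] x[OF that ab(2)] .
      qed
      then show ?thesis by (simp add: sum_distrib_left del: index_mult_mat(1))
    qed
    also have "\<dots> = ?R $$ (a, b)"
      using ab by (simp add: reg_mat_def)
    finally show "?L $$ (a, b) = ?R $$ (a, b)" .
  qed (use A in \<open>auto simp: HS_mat_def reg_mat_def\<close>)
qed

text \<open>The trace of I = \<Sigma> P + lam P. It turns the definition of \<gamma> into the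
  equation assumed in \<open>\<gamma>_t_bound\<close>.\<close>

lemma eff_dim_eq:
  assumes A: "A \<in> carrier_mat n d" and lam: "lam > 0"
  shows "eff_dim n d A lam = real d - lam * (\<Sum>a<d. unit_vec d a \<bullet> (resolvent d lam {..<n} (scaled_row n d A) *\<^sub>v unit_vec d a))"
proof -
  interpret ridge d lam "{..<n}" "scaled_row n d A"
    by unfold_locales (auto simp: lam scaled_row_def)
  have W: "gram n A \<in> carrier_mat d d" using A by (simp add: gram_def)
  have H: "gram n A + lam \<cdot>\<^sub>m 1\<^sub>m d = M"
    using H_mat_eq_reg_mat[OF A, of lam] by (simp add: H_mat_def)
  have "1\<^sub>m d = (gram n A + lam \<cdot>\<^sub>m 1\<^sub>m d) * Q"
    by (simp add: H M_Q)
  also have "\<dots> = gram n A * Q + (lam \<cdot>\<^sub>m 1\<^sub>m d) * Q"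
    by (rule add_mult_distrib_mat[OF W _ Q_carrier]) simp
  also have "(lam \<cdot>\<^sub>m 1\<^sub>m d) * Q = lam \<cdot>\<^sub>m Q"
    by (simp add: mult_smult_assoc_mat[OF one_carrier_mat Q_carrier] left_mult_one_mat[OF Q_carrier])
  finally have "1\<^sub>m d = gram n A * Q + lam \<cdot>\<^sub>m Q" .
  then have diag: "(gram n A * Q) $$ (a, a) = 1 - lam * Q $$ (a, a)" if "a < d" for a
  proof -
    have "(1\<^sub>m d :: real mat) $$ (a, a) = (gram n A * Q + lam \<cdot>\<^sub>m Q) $$ (a, a)"
      by (rule arg_cong[where f = "\<lambda>B. B $$ (a, a)"]) fact
    also have "\<dots> = (gram n A * Q) $$ (a, a) + lam * Q $$ (a, a)"
      using that carrier_matD[OF W] carrier_matD[OF Q_carrier] by (simp del: index_mult_mat(1))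
    finally show ?thesis using that by (simp del: index_mult_mat(1))
  qed
  have "unit_vec d a \<bullet> (Q *\<^sub>v unit_vec d a) = Q $$ (a, a)" if "a < d" for a
    by (rule unit_vec_scalar_prod_mat[OF Q_carrier that that])
  then show ?thesis
    using diag W carrier_matD[OF W]
    by (simp add: eff_dim_def H resolvent_def[symmetric] mat_tr_def sum_subtractf sum_distrib_left del: index_mult_mat(1))
qed

section \<open>Uniform bounds along the sequence and the limit\<close>

theorem theorem4p1:
  fixes n d m :: "nat \<Rightarrow> nat"
    and A :: "nat \<Rightarrow> real mat"
    and F\<Sigma> :: "real measure"
    and y \<sigma>min \<sigma>max lam :: real
  assumes dimA: "\<And>k. A k \<in> carrier_mat (n k) (d k)"
    and m_lim: "filterlim m at_top sequentially"
    and d_lim: "filterlim d at_top sequentially"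
    and ratio: "(\<lambda>k. real (d k) / real (m k)) \<longlonglongrightarrow> y"
    and y_range: "0 \<le> y" "y < 1"
    and F\<Sigma>_dist: "real_distribution F\<Sigma>"
    and esd_conv: "AE u in lborel. u \<ge> 0 \<longrightarrow>
                     (\<lambda>k. esd (gram (n k) (A k)) u) \<longlonglongrightarrow> cdf F\<Sigma> u"
    and norm_fin: "\<exists>B. \<forall>k. (spec_norm (gram (n k) (A k)))^2 \<le> B"
    and \<sigma>min_pos: "\<sigma>min > 0"
    and eig_range: "\<And>k e. eigenvalue (gram (n k) (A k)) e \<Longrightarrow> \<sigma>min \<le> e \<and> e \<le> \<sigma>max"
    and lam_pos: "lam > 0"
    and eff_lt: "\<And>k. eff_dim (n k) (d k) (A k) lam < real (m k)"
  shows "(\<lambda>k. spec_norm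
            (mat_expect (gauss_mat_space (m k) (n k)) (d k) (d k)
              (\<lambda>\<omega>. mat_inv
                 ((1 / (1 - eff_dim (n k) (d k) (A k) lam / real (m k))) \<cdot>\<^sub>m
                    (HS_mat (n k) (d k) (A k) (mat_of_sample (m k) (n k) \<omega>) lam - lam \<cdot>\<^sub>m 1\<^sub>m (d k))
                  + lam \<cdot>\<^sub>m 1\<^sub>m (d k)))
             - mat_inv (H_mat (n k) (d k) (A k) lam)))
         \<longlonglongrightarrow> 0" (is "?s \<longlonglongrightarrow> 0")
proof -
  \<comment> \<open>(1 + y)/2 lies strictly between y and 1, so d/m is eventually below it. As
    d_lambda \<le> d, this gives 1 - d_lambda/m \<ge> (1 - y)/2, whose reciprocal \<open>g\<close>
    bounds \<gamma>.\<close>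
  define g where "g = 2 / (1 - y)"
  \<comment> \<open>The bound of \<open>spec_norm_expectation_Q\<close> with \<gamma> replaced by
    \<open>g\<close> and d/m by 1; it depends on k through m only.\<close>
  define bound where "bound k = 2 * g / lam * (1 / sqrt (real (m k)) + 2 / real (m k)) * (1 + 2 * g)" for k
  have g_pos: "0 < g" using y_range by (simp add: g_def)
  have step: "0 \<le> ?s k \<and> ?s k \<le> bound k"
    if m_pos: "0 < m k" and le: "real (d k) / real (m k) \<le> (1 + y) / 2" for k
  proof -
    define \<gamma> where "\<gamma> = 1 / (1 - eff_dim (n k) (d k) (A k) lam / real (m k))"
    have lt_1: "eff_dim (n k) (d k) (A k) lam / real (m k) < 1"
      using eff_lt[of k] m_pos by simp
    then have \<gamma>_pos: "0 < \<gamma>" by (simp add: \<gamma>_def)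
    interpret sketch "m k" "n k" "d k" lam \<gamma> "scaled_row (n k) (d k) (A k)"
      by unfold_locales (auto simp: m_pos lam_pos \<gamma>_pos scaled_row_def)
    have eff: "eff_dim (n k) (d k) (A k) lam = real (d k) - lam * trP"
      unfolding trP_def by (rule eff_dim_eq[OF dimA lam_pos])
    then have eff_le: "eff_dim (n k) (d k) (A k) lam / real (m k) \<le> real (d k) / real (m k)"
      using trP_nonneg lam_pos by (intro divide_right_mono) auto
    then have ge: "(1 - y) / 2 \<le> 1 - eff_dim (n k) (d k) (A k) lam / real (m k)"
    proof -
      have "(1 - y) / 2 \<le> 1 - p" if "p \<le> q" "q \<le> (1 + y) / 2" for p q :: real
        using that by (simp add: field_simps)
      then show ?thesis using eff_le le .
    qed
    then have \<gamma>_le: "\<gamma> \<le> g"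
      unfolding \<gamma>_def g_def using y_range divide_left_mono[OF ge, of 1] by (simp add: field_simps)
    have \<gamma>_eq: "\<gamma> * (1 - (real (d k) - lam * trP) / real (m k)) = 1"
    proof -
      have "1 / (1 - p) * (1 - p) = 1" if "p < 1" for p :: real
        using that by simp
      then show ?thesis
        unfolding \<gamma>_def eff[symmetric] using lt_1 .
    qed
    have s: "?s k = spec_norm (mat_expect \<Omega> (d k) (d k) R.Q - P)"
      unfolding \<gamma>_def[symmetric] HS_mat_eq_reg_mat[OF dimA less_imp_le[OF \<gamma>_pos]] H_mat_eq_reg_mat[OF dimA]
      by (simp only: resolvent_def)
    have "\<delta> * (1 + 2 * \<gamma> * (real (d k) / real (m k))) \<le> bound k"
      unfolding \<delta>_def bound_def
    proof (rule mult_mono)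
      show "2 * \<gamma> / lam * (1 / sqrt (real (m k)) + 2 / real (m k)) \<le> 2 * g / lam * (1 / sqrt (real (m k)) + 2 / real (m k))"
        using \<gamma>_le lam_pos by (intro mult_right_mono divide_right_mono) auto
      have "2 * \<gamma> * (real (d k) / real (m k)) \<le> 2 * g * 1"
      proof -
        have "(1 + y) / 2 \<le> 1" using y_range by simp
        with le have "real (d k) / real (m k) \<le> 1" by (rule order_trans)
        then show ?thesis using \<gamma>_le \<gamma>_pos by (intro mult_mono) auto
      qed
      then show "1 + 2 * \<gamma> * (real (d k) / real (m k)) \<le> 1 + 2 * g" by simp
    qed (use g_pos \<gamma>_pos lam_pos in auto)
    then show ?thesis
      unfolding s using spec_norm_expectation_Q[OF \<gamma>_eq] by linarith
  qed
  have "eventually (\<lambda>k. 0 < m k) sequentially"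
    using eventually_compose_filterlim[OF eventually_gt_at_top m_lim] .
  moreover have "eventually (\<lambda>k. real (d k) / real (m k) < (1 + y) / 2) sequentially"
    by (rule order_tendstoD(2)[OF ratio]) (use y_range in simp)
  ultimately have ev: "eventually (\<lambda>k. 0 \<le> ?s k \<and> ?s k \<le> bound k) sequentially"
    by eventually_elim (rule step, auto)
  have "filterlim (\<lambda>k. real (m k)) at_top sequentially"
    by (rule filterlim_compose[OF filterlim_real_sequentially m_lim])
  then have "((\<lambda>x. 2 * g / lam * (1 / sqrt x + 2 / x) * (1 + 2 * g)) \<circ> (\<lambda>k. real (m k))) \<longlonglongrightarrow> 0"
    unfolding comp_def
  proof (rule filterlim_compose[rotated])
    have "((\<lambda>x::real. 1 / sqrt x + 2 / x) \<longlongrightarrow> 0) at_top" by real_asymp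
    then show "((\<lambda>x. 2 * g / lam * (1 / sqrt x + 2 / x) * (1 + 2 * g)) \<longlongrightarrow> 0) at_top"
      by (intro tendsto_mult_left_zero tendsto_mult_right_zero)
  qed
  then have "bound \<longlonglongrightarrow> 0"
    by (simp add: bound_def[abs_def] comp_def)
  then show ?thesis
    by (rule tendsto_sandwich[OF _ _ tendsto_const, rotated 2])
       (use ev in \<open>auto elim: eventually_mono\<close>)
qed

end
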